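(* Let $n\ge 3$, let $\Omega\subset\mathbb{R}^n$ be a bounded domain with smooth boundary, and let $m\ge 2$ be an integer. For each $0\le l\le 2m-2$ let $a^l$ be a smooth symmetric $l$-tensor field on $\overline{\Omega}$. Suppose that $$\int_\Omega \sum_{l=0}^{2m-2} a^l_{i_1\cdots i_l}(x)\,\big(D^{i_1\cdots i_l}u\big)(x)\,v(x)\,dx=0$$ for all $u,v\in H^{2m}(\Omega)$ satisfying $\Delta^m u=\Delta^m v=0$ in $\Omega$. Then $a^l=0$ in $\Omega$ for every $0\le l\le 2m-2$.
   Context: $D_j=-\mathrm{i}\,\partial_{x_j}$ and $D^{i_1\cdots i_l}=D_{i_1}\cdots D_{i_l}$ (for $l=0$ this is the identity). Repeated indices are summed from $1$ to $n$. A symmetric $l$-tensor field $a^l$ has components $a^l_{i_1\cdots i_l}$ ($1\le i_j\le n$), invariant under permutation of the indices; a $0$-tensor field is a scalar function. Coefficients may be complex valued. $\Delta^m$ denotes the $m$-th power of the Laplacian. *)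

theory Defs
  imports "HOL-Analysis.Analysis"
begin

fun Dpart :: "'n::finite list \<Rightarrow> (real^'n \<Rightarrow> 'b::real_normed_vector) \<Rightarrow> real^'n \<Rightarrow> 'b" where
  "Dpart [] f = f"
| "Dpart (i # is) f = (\<lambda>x. vector_derivative (\<lambda>t. Dpart is f (x + t *\<^sub>R axis i 1)) (at 0))"

definition smooth_on :: "(real^'n::finite) set \<Rightarrow> (real^'n \<Rightarrow> 'b::real_normed_vector) \<Rightarrow> bool" where
  "smooth_on S f \<longleftrightarrow> (\<forall>is. continuous_on S (Dpart is f) \<and>
     (\<forall>x\<in>S. \<forall>i. ((\<lambda>t. Dpart is f (x + t *\<^sub>R axis i 1)) has_vector_derivative Dpart (i # is) f x) (at 0)))"

definition smooth_on_closure :: "(real^'n::finite) set \<Rightarrow> (real^'n \<Rightarrow> 'b::real_normed_vector) \<Rightarrow> bool" where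
  "smooth_on_closure \<Omega> f \<longleftrightarrow> (\<exists>g. smooth_on UNIV g \<and> (\<forall>x\<in>closure \<Omega>. g x = f x))"

definition smooth_bounded_domain :: "(real^'n::finite) set \<Rightarrow> bool" where
  "smooth_bounded_domain \<Omega> \<longleftrightarrow> open \<Omega> \<and> connected \<Omega> \<and> \<Omega> \<noteq> {} \<and> bounded \<Omega> \<and>
     (\<forall>p\<in>frontier \<Omega>. \<exists>U (\<rho>::real^'n \<Rightarrow> real). open U \<and> p \<in> U \<and> smooth_on U \<rho> \<and>
        (\<forall>x\<in>U. \<exists>i. Dpart [i] \<rho> x \<noteq> 0) \<and> \<Omega> \<inter> U = {x\<in>U. \<rho> x < 0})"

definition L2 :: "(real^'n::finite) set \<Rightarrow> (real^'n \<Rightarrow> complex) \<Rightarrow> bool" where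
  "L2 \<Omega> u \<longleftrightarrow> u \<in> borel_measurable (lebesgue_on \<Omega>) \<and>
     integrable (lebesgue_on \<Omega>) (\<lambda>x. (cmod (u x))\<^sup>2)"

definition test_function :: "(real^'n::finite) set \<Rightarrow> (real^'n \<Rightarrow> complex) \<Rightarrow> bool" where
  "test_function \<Omega> \<phi> \<longleftrightarrow> smooth_on UNIV \<phi> \<and> compact (closure {x. \<phi> x \<noteq> 0})
     \<and> closure {x. \<phi> x \<noteq> 0} \<subseteq> \<Omega>"

definition has_weak_deriv :: "(real^'n::finite) set \<Rightarrow> 'n list \<Rightarrow> (real^'n \<Rightarrow> complex) \<Rightarrow> (real^'n \<Rightarrow> complex) \<Rightarrow> bool" where
  "has_weak_deriv \<Omega> is u g \<longleftrightarrow> (\<forall>\<phi>. test_function \<Omega> \<phi> \<longrightarrow>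
     integral\<^sup>L (lebesgue_on \<Omega>) (\<lambda>x. u x * Dpart is \<phi> x)
       = (-1) ^ length is * integral\<^sup>L (lebesgue_on \<Omega>) (\<lambda>x. g x * \<phi> x))"

definition sobolev_H :: "(real^'n::finite) set \<Rightarrow> nat \<Rightarrow> (real^'n \<Rightarrow> complex) \<Rightarrow> bool" where
  "sobolev_H \<Omega> k u \<longleftrightarrow> L2 \<Omega> u \<and>
     (\<forall>is::'n list. length is \<le> k \<longrightarrow> (\<exists>g. L2 \<Omega> g \<and> has_weak_deriv \<Omega> is u g))"

text \<open>The (a.e.-determined) weak derivative d^{is} u.\<close>
definition weak_deriv :: "(real^'n::finite) set \<Rightarrow> 'n list \<Rightarrow> (real^'n \<Rightarrow> complex) \<Rightarrow> real^'n \<Rightarrow> complex" where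
  "weak_deriv \<Omega> is u = (SOME g. L2 \<Omega> g \<and> has_weak_deriv \<Omega> is u g)"

text \<open>D^{i_1...i_l} u with D_j = -i d/dx_j, in the weak sense.\<close>
definition Dw :: "(real^'n::finite) set \<Rightarrow> 'n list \<Rightarrow> (real^'n \<Rightarrow> complex) \<Rightarrow> real^'n \<Rightarrow> complex" where
  "Dw \<Omega> is u x = (- \<i>) ^ length is * weak_deriv \<Omega> is u x"

text \<open>Delta^m u = sum over j_1..j_m of d_{j1}d_{j1}...d_{jm}d_{jm} u (weak sense).\<close>
definition polylap :: "(real^'n::finite) set \<Rightarrow> nat \<Rightarrow> (real^'n \<Rightarrow> complex) \<Rightarrow> real^'n \<Rightarrow> complex" where
  "polylap \<Omega> m u x = (\<Sum>js\<in>{js::'n list. length js = m}. weak_deriv \<Omega> (concat (map (\<lambda>j. [j, j]) js)) u x)"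

definition smooth_sym_tensor :: "(real^'n::finite) set \<Rightarrow> nat \<Rightarrow> ('n list \<Rightarrow> real^'n \<Rightarrow> complex) \<Rightarrow> bool" where
  "smooth_sym_tensor \<Omega> l a \<longleftrightarrow>
     (\<forall>is. length is = l \<longrightarrow> smooth_on_closure \<Omega> (a is)) \<and>
     (\<forall>is js. length is = l \<longrightarrow> mset js = mset is \<longrightarrow> (\<forall>x\<in>closure \<Omega>. a js x = a is x))"

end

theory Submission
  imports Defs "HOL-Computational_Algebra.Polynomial"
begin

text \<open>
  Let \<open>e, e'\<close> be orthonormal, \<open>\<theta> = e + \<i> e'\<close>, \<open>\<kappa> = e - \<i> e'\<close>, \<open>w = \<theta> \<bullet> x\<close> and \<open>w' = \<kappa> \<bullet> x\<close>. Since \<open>\<theta>\<close> and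
  \<open>\<kappa>\<close> are null vectors, \<open>w\<^sup>r w'\<^sup>s\<close> is polyharmonic of order \<open>m\<close> as soon as \<open>r < m\<close> or \<open>s < m\<close>. Testing
  with \<open>u = w\<^sup>r w'\<^sup>s\<close> and \<open>v = w\<^sup>P\<^sup>-\<^sup>r w'\<^sup>Q\<^sup>-\<^sup>s\<close> for fixed \<open>P, Q\<close> says that a polynomial in \<open>(r, s)\<close> of total
  degree at most \<open>2 m - 2\<close>, whose coefficients in the falling factorial basis are moments of the
  tensors, vanishes at the lattice points of \<open>[0, P] \<times> [0, Q]\<close> at which \<open>u\<close> and \<open>v\<close> are both
  admissible. Multiplied by \<open>(-1)\<^sup>r\<^sup>+\<^sup>s (P choose r) (Q choose s)\<close> it annihilates all polynomials of degree
  less than \<open>P + Q - 2 m + 2\<close>, and its support consists of two opposite boxes; a Vandermonde argument along the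
  diagonals \<open>r - s = const\<close> shows that it is zero. Hence all moments of \<open>a\<^sup>l(x)(e, \<dots>, e)\<close> vanish for every
  unit vector \<open>e\<close>, and Stone-Weierstrass and polarization conclude.
\<close>

section \<open>Polynomials vanishing on two opposite corners of a lattice rectangle\<close>

text \<open>Invertibility of the Vandermonde matrix: the polynomial \<open>q\<close>, of degree
  \<open>card D - 1\<close>, vanishes at every node except \<open>x d\<close>, so pairing
  \<open>M\<close> with it isolates \<open>M d\<close>.\<close>

lemma sum_moments_zero_imp_zero:
  fixes M x :: "'a \<Rightarrow> complex"
  assumes "finite D" "inj_on x D"
    and mom: "\<And>f. f < card D \<Longrightarrow> (\<Sum>d\<in>D. M d * x d ^ f) = 0"
    and "d \<in> D"
  shows "M d = 0"
proof -
  define q where "q = (\<Prod>c\<in>D - {d}. [:- x c, 1:])"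
  have deg: "degree q < card D"
  proof -
    have "degree q = (\<Sum>c\<in>D - {d}. degree [:- x c, 1:])"
      unfolding q_def by (rule degree_prod_eq_sum_degree) auto
    also have "\<dots> = card D - 1" using assms by simp
    also have "\<dots> < card D" using assms by (metis card_gt_0_iff diff_less empty_iff zero_less_one)
    finally show ?thesis .
  qed
  have van: "poly q (x c) = 0" if "c \<in> D" "c \<noteq> d" for c
    using that assms(1) by (auto simp: q_def poly_prod intro: prod_zero)
  have nz: "poly q (x d) \<noteq> 0"
    using assms by (auto simp: q_def poly_prod inj_on_def)
  have "(\<Sum>c\<in>D. M c * poly q (x c)) = (\<Sum>c\<in>D. \<Sum>f\<le>degree q. coeff q f * (M c * x c ^ f))"
    by (simp add: poly_altdef sum_distrib_left algebra_simps)
  also have "\<dots> = (\<Sum>f\<le>degree q. coeff q f * (\<Sum>c\<in>D. M c * x c ^ f))"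
    by (subst sum.swap) (simp add: sum_distrib_left)
  also have "\<dots> = 0" using deg by (intro sum.neutral) (auto simp: mom)
  finally have "(\<Sum>c\<in>D. M c * poly q (x c)) = 0" .
  moreover have "(\<Sum>c\<in>D. M c * poly q (x c)) = M d * poly q (x d)"
    using assms van by (subst sum.remove[of _ d]) auto
  ultimately show ?thesis using nz by simp
qed

section \<open>Finite differences and total degree\<close>

text \<open>Pascal's rule, read as summation by parts: a difference of order \<open>P + 1\<close> is
  the difference of order \<open>P\<close> of a first difference.\<close>

lemma alternating_binomial_sum_Suc:
  fixes f :: "nat \<Rightarrow> complex"
  shows "(\<Sum>k\<le>Suc P. (-1)^k * of_nat (Suc P choose k) * f k)
       = (\<Sum>k\<le>P. (-1)^k * of_nat (P choose k) * (f k - f (Suc k)))"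
proof -
  have "(\<Sum>k\<le>Suc P. (-1)^k * of_nat (Suc P choose k) * f k)
      = f 0 + (\<Sum>k\<le>P. (-1)^Suc k * of_nat (Suc P choose Suc k) * f (Suc k))"
    by (subst sum.atMost_Suc_shift) simp
  also have "(\<Sum>k\<le>P. (-1)^Suc k * of_nat (Suc P choose Suc k) * f (Suc k))
     = (\<Sum>k\<le>P. (-1)^Suc k * of_nat (P choose Suc k) * f (Suc k))
       - (\<Sum>k\<le>P. (-1)^k * of_nat (P choose k) * f (Suc k))"
    unfolding sum_subtractf[symmetric] by (intro sum.cong refl) (simp add: algebra_simps)
  also have "f 0 + ((\<Sum>k\<le>P. (-1)^Suc k * of_nat (P choose Suc k) * f (Suc k))
       - (\<Sum>k\<le>P. (-1)^k * of_nat (P choose k) * f (Suc k)))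
    = (\<Sum>k\<le>Suc P. (-1)^k * of_nat (P choose k) * f k) - (\<Sum>k\<le>P. (-1)^k * of_nat (P choose k) * f (Suc k))"
    by (subst sum.atMost_Suc_shift) simp
  also have "\<dots> = (\<Sum>k\<le>P. (-1)^k * of_nat (P choose k) * (f k - f (Suc k)))"
    by (simp add: right_diff_distrib sum_subtractf binomial_eq_0)
  finally show ?thesis .
qed

text \<open>A first difference of \<open>k ^ e\<close> has degree less than \<open>e\<close>, so
  each application of the recursion lowers the order and the degree together.\<close>

lemma alternating_binomial_power_sum:
  "e < P \<Longrightarrow> (\<Sum>k\<le>P. (-1)^k * of_nat (P choose k) * (of_nat k :: complex) ^ e) = 0"
proof (induction P arbitrary: e)
  case (Suc P)
  have diff: "(of_nat k :: complex) ^ e - of_nat (Suc k) ^ e = - (\<Sum>j<e. of_nat (e choose j) * of_nat k ^ j)" for k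
  proof -
    have "(of_nat k + 1 :: complex) ^ e = (\<Sum>j\<le>e. of_nat (e choose j) * of_nat k ^ j)"
      by (subst binomial_ring) simp
    also have "{..e} = insert e {..<e}" by auto
    finally show ?thesis by (simp add: add.commute)
  qed
  have "(\<Sum>k\<le>Suc P. (-1)^k * of_nat (Suc P choose k) * (of_nat k :: complex) ^ e)
      = (\<Sum>k\<le>P. \<Sum>j<e. - of_nat (e choose j) * ((-1)^k * of_nat (P choose k) * of_nat k ^ j))"
    by (simp only: alternating_binomial_sum_Suc diff)
       (simp add: sum_distrib_left sum_negf algebra_simps)
  also have "\<dots> = (\<Sum>j<e. - of_nat (e choose j) * (\<Sum>k\<le>P. (-1)^k * of_nat (P choose k) * of_nat k ^ j))"
    by (subst sum.swap) (simp add: sum_distrib_left)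
  also have "\<dots> = 0" using Suc by (intro sum.neutral) auto
  finally show ?case .
qed simp

text \<open>Upper bounds for the total degree, stated for functions on lattice points instead of
  formal polynomials. The closure properties then follow by induction on the generation from
  monomials.\<close>

inductive total_degree_le :: "nat \<Rightarrow> (nat \<Rightarrow> nat \<Rightarrow> complex) \<Rightarrow> bool" where
  monomial: "i + j \<le> n \<Longrightarrow> total_degree_le n (\<lambda>x y. c * of_nat x ^ i * of_nat y ^ j)"
| add: "total_degree_le n f \<Longrightarrow> total_degree_le n g \<Longrightarrow> total_degree_le n (\<lambda>x y. f x y + g x y)"

lemma total_degree_le_mult_monomial:
  assumes "total_degree_le n f" "i + j \<le> k"
  shows "total_degree_le (n + k) (\<lambda>x y. f x y * (c * of_nat x ^ i * of_nat y ^ j))"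
  using assms(1)
proof induction
  case (monomial i' j' n c')
  have "total_degree_le (n + k) (\<lambda>x y. (c' * c) * of_nat x ^ (i' + i) * of_nat y ^ (j' + j))"
    using monomial assms(2) by (intro total_degree_le.monomial) auto
  then show ?case by (simp add: power_add mult_ac)
next
  case (add n f g)
  show ?case using total_degree_le.add[OF add.IH] by (simp add: distrib_right)
qed

lemma total_degree_le_mult:
  assumes f: "total_degree_le n f" and g: "total_degree_le k g"
  shows "total_degree_le (n + k) (\<lambda>x y. f x y * g x y)"
  using g f
proof induction
  case (monomial i j k c)
  then show ?case by (rule_tac total_degree_le_mult_monomial)
next
  case (add k g h)
  show ?case using total_degree_le.add[OF add.IH(1)[OF add.prems] add.IH(2)[OF add.prems]]
    by (simp add: distrib_left)
qed

lemma total_degree_le_mono: "total_degree_le n f \<Longrightarrow> n \<le> k \<Longrightarrow> total_degree_le k f"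
  by (induction rule: total_degree_le.induct) (auto intro: total_degree_le.intros)

lemma total_degree_le_const: "total_degree_le n (\<lambda>x y. c)"
  using total_degree_le.monomial[of 0 0 n c] by simp

lemma total_degree_le_fst: "total_degree_le 1 (\<lambda>x y. of_nat x)"
  using total_degree_le.monomial[of 1 0 1 1] by simp

lemma total_degree_le_snd: "total_degree_le 1 (\<lambda>x y. of_nat y)"
  using total_degree_le.monomial[of 0 1 1 1] by simp

lemma total_degree_le_diff:
  assumes "total_degree_le n f" "total_degree_le n g"
  shows "total_degree_le n (\<lambda>x y. f x y - g x y)"
  using total_degree_le.add[OF assms(1) total_degree_le_mult[OF assms(2) total_degree_le_const[of 0 "-1"], simplified]]
  by simp

lemma total_degree_le_sum:
  assumes "finite I" "\<And>i. i \<in> I \<Longrightarrow> total_degree_le n (f i)"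
  shows "total_degree_le n (\<lambda>x y. \<Sum>i\<in>I. f i x y)"
  using assms by (induction I rule: finite_induct) (auto intro: total_degree_le.add total_degree_le_const)

lemma total_degree_le_power:
  assumes "total_degree_le 1 f"
  shows "total_degree_le k (\<lambda>x y. f x y ^ k)"
proof (induction k)
  case (Suc k)
  then show ?case using total_degree_le_mult[OF assms Suc] by simp
qed (simp add: total_degree_le_const)

text \<open>For a monomial the double sum factors, and \<open>i + j < P + Q\<close> forces
  \<open>i < P\<close> or \<open>j < Q\<close>, so one of the factors vanishes.\<close>

lemma alternating_binomial_sum_total_degree:
  assumes "total_degree_le n f" "n < P + Q"
  shows "(\<Sum>x\<le>P. \<Sum>y\<le>Q. (-1)^x * of_nat (P choose x) * ((-1)^y * of_nat (Q choose y)) * f x y) = 0"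
  using assms
proof induction
  case (monomial i j n c)
  have "(\<Sum>x\<le>P. \<Sum>y\<le>Q. (-1)^x * of_nat (P choose x) * ((-1)^y * of_nat (Q choose y)) * (c * of_nat x ^ i * of_nat y ^ j))
      = c * (\<Sum>x\<le>P. (-1)^x * of_nat (P choose x) * of_nat x ^ i) * (\<Sum>y\<le>Q. (-1)^y * of_nat (Q choose y) * of_nat y ^ j)"
    by (simp add: sum_product sum_distrib_left mult_ac)
  moreover have "i < P \<or> j < Q" using monomial by linarith
  ultimately show ?case by (auto simp: alternating_binomial_power_sum)
next
  case (add n f g)
  then show ?case by (simp add: distrib_left sum.distrib)
qed

text \<open>The falling factorial \<open>n (n - 1) ... (n - k + 1)\<close>. Its vanishing for
  \<open>n < k\<close> neutralizes the truncated subtraction in exponents such as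
  \<open>p - k\<close> later on.\<close>

definition ffact :: "nat \<Rightarrow> nat \<Rightarrow> complex" where
  "ffact n k = (\<Prod>i<k. of_nat n - of_nat i)"

lemma ffact_0 [simp]: "ffact n 0 = 1"
  by (simp add: ffact_def)

lemma ffact_Suc: "ffact n (Suc k) = (of_nat n - of_nat k) * ffact n k"
  by (simp add: ffact_def mult.commute)

lemma ffact_eq_0: "n < k \<Longrightarrow> ffact n k = 0"
  by (auto simp: ffact_def intro!: prod_zero)

lemma ffact_self_neq_0: "ffact n n \<noteq> 0"
  by (auto simp: ffact_def)

lemma total_degree_le_ffact_fst: "total_degree_le k (\<lambda>x y. ffact x k)"
proof (induction k)
  case (Suc k)
  show ?case
    using total_degree_le_mult[OF total_degree_le_diff[OF total_degree_le_fst total_degree_le_const] Suc]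
    by (simp add: ffact_Suc)
qed (simp add: total_degree_le_const)

lemma total_degree_le_ffact_snd: "total_degree_le k (\<lambda>x y. ffact y k)"
proof (induction k)
  case (Suc k)
  show ?case
    using total_degree_le_mult[OF total_degree_le_diff[OF total_degree_le_snd total_degree_le_const] Suc]
    by (simp add: ffact_Suc)
qed (simp add: total_degree_le_const)

text \<open>The supporting diagonals \<open>x - y = d\<close> lie in \<open>[m - Q, P - m]\<close>. After \<open>t\<close> outermost diagonals on
  either side have been removed, the moments \<open>x\<^sup>e (x - y)\<^sup>f\<close> with \<open>e \<le> 2 t + 1\<close> force all diagonal
  moments of order at most \<open>2 t + 1\<close> to vanish; an outermost diagonal carries at most \<open>2 t + 2\<close>
  points, so it can be removed as well.\<close>

lemma two_box_support_moments_zero: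
  fixes g :: "nat \<Rightarrow> nat \<Rightarrow> complex"
  assumes supp: "\<And>x y. g x y \<noteq> 0 \<Longrightarrow> x \<le> P \<and> y \<le> Q \<and> ((m \<le> x \<and> m \<le> y) \<or> (x + m \<le> P \<and> y + m \<le> Q))"
    and mom: "\<And>e f. e + f + 2 * m \<le> P + Q + 1 \<Longrightarrow>
      (\<Sum>x\<le>P. \<Sum>y\<le>Q. g x y * of_nat x ^ e * (of_nat x - of_nat y) ^ f) = 0"
  shows "g x y = 0"
proof (cases "m \<le> P \<and> m \<le> Q")
  case False
  then show ?thesis using supp[of x y] by linarith
next
  case True
  \<comment> \<open>\<open>M e d\<close> is the moment of order \<open>e\<close> in \<open>x\<close>
    along the diagonal \<open>x - y = d\<close>. Diagonals are indexed by integers because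
    \<open>d\<close> may be negative.\<close>
  define M where "M e d = (\<Sum>x\<le>P. \<Sum>y\<le>Q. if int x - int y = d then g x y * of_nat x ^ e else 0)" for e d
  define D where "D t = {int m - int Q + int t .. int P - int m - int t}" for t
  have stage: "g x y \<noteq> 0 \<longrightarrow> int x - int y \<in> D t" for t x y
  proof (induction t arbitrary: x y)
    case 0
    show ?case using supp[of x y] True by (auto simp: D_def)
  next
    case (Suc t)
    have cardD: "card (D t) = nat (int P + int Q + 1 - 2 * int m - 2 * int t)"
      by (simp add: D_def algebra_simps)
    \<comment> \<open>The count is sharp: \<open>e \<le> 2 * t + 1\<close> and
      \<open>f < card (D t)\<close> give just \<open>e + f + 2 * m \<le> P + Q + 1\<close>. A
      Vandermonde argument in \<open>d\<close> then separates the diagonals.\<close>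
    have Mz: "M e d = 0" if "e \<le> 2 * t + 1" "d \<in> D t" for e d
    proof (rule sum_moments_zero_imp_zero[where x = of_int and D = "D t" and M = "M e"])
      fix f assume f: "f < card (D t)"
      have "(\<Sum>d\<in>D t. M e d * of_int d ^ f)
          = (\<Sum>d\<in>D t. \<Sum>x\<le>P. \<Sum>y\<le>Q. if int x - int y = d then g x y * of_nat x ^ e * of_int d ^ f else 0)"
        unfolding M_def sum_distrib_right by (intro sum.cong refl) auto
      also have "\<dots> = (\<Sum>x\<le>P. \<Sum>y\<le>Q. \<Sum>d\<in>D t. if int x - int y = d then g x y * of_nat x ^ e * of_int d ^ f else 0)"
        by (subst sum.swap, intro sum.cong refl, rule sum.swap)
      also have "\<dots> = (\<Sum>x\<le>P. \<Sum>y\<le>Q. g x y * of_nat x ^ e * (of_nat x - of_nat y) ^ f)"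
      proof (intro sum.cong refl)
        fix x y
        have "finite (D t)" by (simp add: D_def)
        then have "(\<Sum>d\<in>D t. if int x - int y = d then g x y * of_nat x ^ e * of_int d ^ f else 0)
           = (if int x - int y \<in> D t then g x y * of_nat x ^ e * of_int (int x - int y) ^ f else 0)"
          by (subst sum.delta') (auto split: if_splits)
        also have "\<dots> = g x y * of_nat x ^ e * (of_nat x - of_nat y) ^ f"
          using Suc[of x y] by auto
        finally show "(\<Sum>d\<in>D t. if int x - int y = d then g x y * of_nat x ^ e * of_int d ^ f else 0)
           = g x y * of_nat x ^ e * (of_nat x - of_nat y) ^ f" .
      qed
      also have "\<dots> = 0" using f that cardD by (intro mom) linarith
      finally show "(\<Sum>d\<in>D t. M e d * of_int d ^ f) = 0" .
    qed (use that in \<open>auto simp: D_def inj_on_def\<close>)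
    have edge: "g x y = 0" if d: "int x - int y = d" and dD: "d \<in> D t"
      and d_edge: "d = int P - int m - int t \<or> d = int m - int Q + int t" for x y d
    proof (rule ccontr)
      assume nz: "g x y \<noteq> 0"
      \<comment> \<open>The abscissae of the support points on the outermost diagonal
        \<open>d\<close>; a second Vandermonde argument, now in \<open>x\<close>, is applied to
        them.\<close>
      define X where "X = {x. x \<le> P \<and> x - d \<ge> 0 \<and> x - d \<le> Q \<and> g x (nat (int x - d)) \<noteq> 0}"
      have fin: "finite X" by (rule finite_subset[of _ "{..P}"]) (auto simp: X_def)
      have cardX: "card X \<le> 2 * t + 2"
      proof -
        \<comment> \<open>Each of the two boxes meets an outermost diagonal in at most
          \<open>t + 1\<close> points. On the upper edge with \<open>d \<ge> 0\<close> their
          abscissae start at \<open>d\<close> and \<open>d + m\<close>; in the other cases they lie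
          in intervals starting at \<open>0\<close> and \<open>m\<close>.\<close>
        define lo where "lo = (if d = int P - int m - int t then nat d else 0)"
        have "X \<subseteq> {lo..lo + t} \<union> {lo + m..lo + m + t}"
        proof
          fix z assume z: "z \<in> X"
          define y' where "y' = nat (int z - d)"
          have y': "int y' = int z - d" "y' \<le> Q" using z by (auto simp: X_def y'_def)
          have s: "g z y' \<noteq> 0" using z by (auto simp: X_def y'_def)
          show "z \<in> {lo..lo + t} \<union> {lo + m..lo + m + t}"
            using supp[OF s] y' d_edge dD True unfolding lo_def D_def
            by (auto split: if_splits)
        qed
        then have "card X \<le> card ({lo..lo + t} \<union> {lo + m..lo + m + t})" by (intro card_mono) auto
        also have "\<dots> \<le> card {lo..lo + t} + card {lo + m..lo + m + t}" by (rule card_Un_le)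
        finally show ?thesis by simp
      qed
      have "g x (nat (int x - d)) = 0"
      proof (rule sum_moments_zero_imp_zero[where x = of_nat and D = X and M = "\<lambda>x. g x (nat (int x - d))"])
        fix e assume "e < card X"
        then have "e \<le> 2 * t + 1" using cardX by simp
        then have "M e d = 0" using Mz dD by blast
        have "M e d = (\<Sum>x\<le>P. if x \<in> X then g x (nat (int x - d)) * of_nat x ^ e else 0)"
          unfolding M_def
        proof (intro sum.cong refl)
          fix x assume x: "x \<in> {..P}"
          have "(\<Sum>y\<le>Q. if int x - int y = d then g x y * of_nat x ^ e else 0)
              = (\<Sum>y\<le>Q. if y = nat (int x - d) \<and> 0 \<le> int x - d then g x y * of_nat x ^ e else 0)"
            by (intro sum.cong refl) auto
          also have "\<dots> = (if x \<in> X then g x (nat (int x - d)) * of_nat x ^ e else 0)"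
          proof (cases "0 \<le> int x - d")
            case True
            then show ?thesis using x by (auto simp: X_def)
          next
            case False
            then show ?thesis by (auto simp: X_def)
          qed
          finally show "(\<Sum>y\<le>Q. if int x - int y = d then g x y * of_nat x ^ e else 0)
             = (if x \<in> X then g x (nat (int x - d)) * of_nat x ^ e else 0)" .
        qed
        also have "\<dots> = (\<Sum>x\<in>X. g x (nat (int x - d)) * of_nat x ^ e)"
          by (rule sum.mono_neutral_cong_right) (auto simp: X_def)
        finally show "(\<Sum>x\<in>X. g x (nat (int x - d)) * of_nat x ^ e) = 0" using \<open>M e d = 0\<close> by simp
      next
        show "x \<in> X" using nz supp[OF nz] d by (auto simp: X_def)
      qed (use fin in \<open>auto simp: inj_on_def\<close>)
      moreover have "nat (int x - d) = y" using d by simp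
      ultimately show False using nz by simp
    qed
    show ?case
    proof
      assume nz: "g x y \<noteq> 0"
      have dD: "int x - int y \<in> D t" using Suc nz by blast
      have "int x - int y \<noteq> int P - int m - int t" "int x - int y \<noteq> int m - int Q + int t"
        using edge[OF refl dD] nz by auto
      then show "int x - int y \<in> D (Suc t)" using dD by (auto simp: D_def)
    qed
  qed
  \<comment> \<open>After this many removals no diagonal is left to carry support.\<close>
  have "D (P + Q + 1) = {}" by (auto simp: D_def)
  then show ?thesis using stage[of x y "P + Q + 1"] by auto
qed

text \<open>Where \<open>van\<close> does not apply, either \<open>m \<le> x\<close> and
  \<open>m \<le> y\<close>, or \<open>x + m \<le> P\<close> and \<open>y + m \<le> Q\<close>: these
  are the two boxes. The binomially weighted values \<open>g\<close> of the expansion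
  \<open>p\<close> therefore satisfy the support condition of
  \<open>two_box_support_moments_zero\<close>, and the result is \<open>p = 0\<close> on the whole
  rectangle.\<close>

lemma ffact_expansion_zero_on_corners_imp_zero:
  fixes d :: "nat \<Rightarrow> nat \<Rightarrow> complex"
  assumes m: "m \<ge> 1"
    and van: "\<And>x y. x \<le> P \<Longrightarrow> y \<le> Q \<Longrightarrow> x < m \<or> y < m \<Longrightarrow> P - x < m \<or> Q - y < m \<Longrightarrow>
      (\<Sum>l\<le>2*m-2. \<Sum>k\<le>l. d l k * ffact x k * ffact y (l - k)) = 0"
    and lk: "l \<le> 2*m-2" "k \<le> l" "k \<le> P" "l - k \<le> Q"
  shows "d l k = 0"
proof -
  define p where "p x y = (\<Sum>l\<le>2*m-2. \<Sum>k\<le>l. d l k * ffact x k * ffact y (l - k))" for x y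
  define g where "g x y = (if x \<le> P \<and> y \<le> Q then (-1)^x * of_nat (P choose x) * ((-1)^y * of_nat (Q choose y)) * p x y else 0)" for x y
  have td: "total_degree_le (2*m-2) p"
    unfolding p_def
  proof (intro total_degree_le_sum finite_atMost)
    fix l k assume "l \<in> {..2*m-2}" "k \<in> {..l}"
    then have "k + (l - k) \<le> 2*m-2" by auto
    then show "total_degree_le (2*m-2) (\<lambda>x y. d l k * ffact x k * ffact y (l - k))"
      using total_degree_le_mono[OF total_degree_le_mult[OF total_degree_le_mult[OF total_degree_le_const[of 0 "d l k"]
            total_degree_le_ffact_fst] total_degree_le_ffact_snd]] by simp
  qed
  have "g x y = 0" for x y
  proof (rule two_box_support_moments_zero[where P = P and Q = Q and m = m])
    fix x y assume "g x y \<noteq> 0"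
    then have "x \<le> P" "y \<le> Q" "p x y \<noteq> 0" by (auto simp: g_def split: if_splits)
    then show "x \<le> P \<and> y \<le> Q \<and> ((m \<le> x \<and> m \<le> y) \<or> (x + m \<le> P \<and> y + m \<le> Q))"
      using van[of x y] unfolding p_def by linarith
  next
    fix e f assume ef: "e + f + 2 * m \<le> P + Q + 1"
    \<comment> \<open>Since \<open>m \<ge> 1\<close>, the bound \<open>ef\<close> yields
      \<open>2 * m - 2 + e + f < P + Q\<close>, the degree range annihilated by the binomial
      weights.\<close>
    have "total_degree_le (2*m-2 + (e + f)) (\<lambda>x y. p x y * (of_nat x ^ e * (of_nat x - of_nat y) ^ f))"
      by (intro total_degree_le_mult td total_degree_le_power total_degree_le_diff total_degree_le_fst total_degree_le_snd)
    then have "(\<Sum>x\<le>P. \<Sum>y\<le>Q. (-1)^x * of_nat (P choose x) * ((-1)^y * of_nat (Q choose y)) *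
        (p x y * (of_nat x ^ e * (of_nat x - of_nat y) ^ f))) = 0"
      by (rule alternating_binomial_sum_total_degree) (use ef m in linarith)
    then show "(\<Sum>x\<le>P. \<Sum>y\<le>Q. g x y * of_nat x ^ e * (of_nat x - of_nat y) ^ f) = 0"
      by (simp add: g_def mult_ac)
  qed
  note g0 = this
  have pz: "p x y = 0" if "x \<le> P" "y \<le> Q" for x y
  proof -
    have "(-1)^x * of_nat (P choose x) * ((-1)^y * of_nat (Q choose y)) * p x y = 0"
      using g0[of x y] that by (simp add: g_def)
    then show ?thesis using that by (simp add: binomial_eq_0_iff)
  qed
  \<comment> \<open>Triangular inversion: at the point \<open>(k, l - k)\<close> only the terms with
    \<open>k' \<le> k\<close> and \<open>l' - k' \<le> l - k\<close> survive. All of them except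
    \<open>d l k\<close> have smaller \<open>l'\<close> and vanish by induction.\<close>
  show ?thesis using lk
  proof (induction l arbitrary: k rule: less_induct)
    case (less l)
    have "0 = p k (l - k)" using pz less.prems by simp
    also have "\<dots> = (\<Sum>l'\<le>2*m-2. \<Sum>k'\<le>l'. if l' = l \<and> k' = k then d l k * ffact k k * ffact (l - k) (l - k) else 0)"
      unfolding p_def
    proof (intro sum.cong refl)
      fix l' k' assume *: "l' \<in> {..2*m-2}" "k' \<in> {..l'}"
      consider "k < k'" | "l - k < l' - k'" | "l' < l" "k' \<le> k" "l' - k' \<le> l - k" | "l' = l" "k' = k"
        using * less.prems by fastforce
      then show "d l' k' * ffact k k' * ffact (l - k) (l' - k')
         = (if l' = l \<and> k' = k then d l k * ffact k k * ffact (l - k) (l - k) else 0)"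
      proof cases
        case 3
        then show ?thesis using less.IH[of l' k'] less.prems * by auto
      qed (auto simp: ffact_eq_0)
    qed
    also have "\<dots> = (\<Sum>l'\<le>2*m-2. if l' = l then d l k * ffact k k * ffact (l - k) (l - k) else 0)"
      by (intro sum.cong refl) (use less.prems in \<open>auto simp: sum.delta\<close>)
    also have "\<dots> = d l k * ffact k k * ffact (l - k) (l - k)"
      using less.prems by (subst sum.delta) auto
    finally show ?case by (simp add: ffact_self_neq_0)
  qed
qed

section \<open>Polyharmonic monomials on a null plane\<close>

lemma finite_lists_length: "finite {is::'n::finite list. length is = l}"
  using finite_lists_length_eq[of "UNIV :: 'n set" l] by simp

lemma sum_lists_length_Suc:
  fixes f :: "'n::finite list \<Rightarrow> 'b::comm_monoid_add"
  shows "(\<Sum>is\<in>{is. length is = Suc l}. f is) = (\<Sum>i\<in>UNIV. \<Sum>is\<in>{is. length is = l}. f (i # is))"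
proof -
  have "(\<Sum>i\<in>UNIV. \<Sum>is\<in>{is. length is = l}. f (i # is))
      = (\<Sum>(i, is)\<in>UNIV \<times> {is. length is = l}. f (i # is))"
    by (rule sum.cartesian_product)
  also have "\<dots> = (\<Sum>is\<in>(\<lambda>(i, is). i # is) ` (UNIV \<times> {is. length is = l}). f is)"
    by (subst sum.reindex) (auto simp: inj_on_def case_prod_unfold)
  also have "(\<lambda>(i, is). i # is) ` (UNIV \<times> {is. length is = l}) = {is::'n list. length is = Suc l}"
    by (auto simp: length_Suc_conv image_iff)
  finally show ?thesis by simp
qed

text \<open>The distributive expansion of an \<open>l\<close>-th power. It will turn the sum over
  index lists in the iterated Laplacian into a power of a polynomial.\<close>

lemma sum_lists_prod_list:
  fixes f :: "'n::finite \<Rightarrow> 'b::comm_semiring_1"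
  shows "(\<Sum>is\<in>{is. length is = l}. prod_list (map f is)) = (\<Sum>i\<in>UNIV. f i) ^ l"
proof (induction l)
  case (Suc l)
  then show ?case
    by (simp add: sum_lists_length_Suc sum_distrib_left[symmetric] sum_distrib_right)
qed simp

text \<open>Bilinear, without complex conjugation, so that nonzero null vectors exist.\<close>

definition cinner :: "('n::finite \<Rightarrow> complex) \<Rightarrow> real^'n \<Rightarrow> complex" where
  "cinner \<theta> x = (\<Sum>i\<in>UNIV. \<theta> i * of_real (x $ i))"

lemma continuous_on_cinner [continuous_intros]: "continuous_on S (cinner \<theta>)"
  unfolding cinner_def by (intro continuous_intros)

lemma cinner_add_axis: "cinner \<theta> (x + t *\<^sub>R axis i 1) = cinner \<theta> x + of_real t * \<theta> i"
proof -
  have "cinner \<theta> (x + t *\<^sub>R axis i 1) = cinner \<theta> x + (\<Sum>j\<in>UNIV. if j = i then of_real t * \<theta> i else 0)"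
    unfolding cinner_def sum.distrib[symmetric]
    by (intro sum.cong refl) (auto simp: axis_def algebra_simps)
  then show ?thesis by simp
qed

definition bimonomial :: "('n::finite \<Rightarrow> complex) \<Rightarrow> ('n \<Rightarrow> complex) \<Rightarrow> nat \<Rightarrow> nat \<Rightarrow> real^'n \<Rightarrow> complex" where
  "bimonomial \<theta> \<kappa> p q x = cinner \<theta> x ^ p * cinner \<kappa> x ^ q"

lemma continuous_on_bimonomial [continuous_intros]: "continuous_on S (bimonomial \<theta> \<kappa> p q)"
  unfolding bimonomial_def by (intro continuous_intros)

lemma bimonomial_has_vector_derivative:
  "((\<lambda>t. bimonomial \<theta> \<kappa> p q (x + t *\<^sub>R axis i 1)) has_vector_derivative
     of_nat p * \<theta> i * bimonomial \<theta> \<kappa> (p - 1) q x + of_nat q * \<kappa> i * bimonomial \<theta> \<kappa> p (q - 1) x) (at 0)"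
proof -
  \<comment> \<open>The derivative is computed in a complex variable \<open>z\<close>, where the
    calculus of holomorphic functions applies, and is then restricted to the real line.\<close>
  have "((\<lambda>z. (cinner \<theta> x + z * \<theta> i) ^ p * (cinner \<kappa> x + z * \<kappa> i) ^ q) has_field_derivative
      of_nat p * \<theta> i * bimonomial \<theta> \<kappa> (p - 1) q x + of_nat q * \<kappa> i * bimonomial \<theta> \<kappa> p (q - 1) x) (at (of_real 0))"
    by (auto intro!: derivative_eq_intros simp: bimonomial_def algebra_simps)
  moreover have "(of_real has_vector_derivative (1::complex)) (at 0)"
    using has_vector_derivative_of_real[OF DERIV_ident, of "at 0"] by simp
  ultimately show ?thesis
    using field_vector_diff_chain_at by (fastforce simp: bimonomial_def cinner_add_axis o_def)
qed

text \<open>The coefficient of \<open>X\<^sup>k\<close> in this product collects the terms of \<open>\<partial>\<^sup>i\<^sup>s (w\<^sup>p w'\<^sup>q)\<close> in which \<open>k\<close> of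
  the derivatives fall on \<open>w = \<theta> \<bullet> x\<close> and the others on \<open>w' = \<kappa> \<bullet> x\<close>.\<close>

definition dpoly :: "('n \<Rightarrow> complex) \<Rightarrow> ('n \<Rightarrow> complex) \<Rightarrow> 'n list \<Rightarrow> complex poly" where
  "dpoly \<theta> \<kappa> is = prod_list (map (\<lambda>i. [:\<kappa> i, \<theta> i:]) is)"

lemma degree_dpoly: "degree (dpoly \<theta> \<kappa> is) \<le> length is"
proof (induction "is")
  case (Cons i "is")
  have "degree (dpoly \<theta> \<kappa> (i # is)) \<le> degree [:\<kappa> i, \<theta> i:] + degree (dpoly \<theta> \<kappa> is)"
    unfolding dpoly_def by (simp only: list.map prod_list.Cons) (rule degree_mult_le)
  also have "\<dots> \<le> 1 + length is"
    using Cons by (intro add_mono) auto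
  finally show ?case by simp
qed (simp add: dpoly_def)

lemma coeff_dpoly_Cons:
  "coeff (dpoly \<theta> \<kappa> (i # is)) k =
     \<kappa> i * coeff (dpoly \<theta> \<kappa> is) k + (case k of 0 \<Rightarrow> 0 | Suc k \<Rightarrow> \<theta> i * coeff (dpoly \<theta> \<kappa> is) k)"
  by (auto simp: dpoly_def split: nat.splits)

text \<open>Closed form of the derivative along \<open>is\<close>: \<open>ffact p k\<close> and
  \<open>ffact q (length is - k)\<close> come from differentiating the two powers, and they vanish
  whenever a subtraction in the exponents is truncated.\<close>

definition bimonomial_deriv where
  "bimonomial_deriv \<theta> \<kappa> p q is x = (\<Sum>k\<le>length is. coeff (dpoly \<theta> \<kappa> is) k * ffact p k * ffact q (length is - k) *
      bimonomial \<theta> \<kappa> (p - k) (q - (length is - k)) x)"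

lemma ffact_mult_of_nat_diff: "ffact p k * of_nat (p - k) = ffact p (Suc k)"
  by (cases "k \<le> p") (auto simp: ffact_Suc ffact_eq_0 of_nat_diff)

text \<open>One more derivative falls either on \<open>w'\<close> or on \<open>w\<close>, which
  matches multiplication of the generating polynomial by \<open>\<kappa> i + \<theta> i X\<close>.
  The proof is the product rule followed by an index shift.\<close>

lemma bimonomial_deriv_has_vector_derivative:
  "((\<lambda>t. bimonomial_deriv \<theta> \<kappa> p q is (x + t *\<^sub>R axis i 1)) has_vector_derivative
     bimonomial_deriv \<theta> \<kappa> p q (i # is) x) (at 0)"
proof -
  define l where "l = length is"
  define c where "c = coeff (dpoly \<theta> \<kappa> is)"
  define E where "E k j = ffact p k * ffact q j * bimonomial \<theta> \<kappa> (p - k) (q - j) x" for k j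
  \<comment> \<open>Allows the sum of the \<open>\<kappa>\<close> terms to be extended to
    \<open>k = Suc l\<close>, so that it can be merged with the shifted sum of the
    \<open>\<theta>\<close> terms.\<close>
  have c0: "c (Suc l) = 0"
    using degree_dpoly[of \<theta> \<kappa> "is"] by (simp add: c_def l_def coeff_eq_0)
  have trm: "c k * ffact p k * ffact q (l - k) *
      (of_nat (p - k) * \<theta> i * bimonomial \<theta> \<kappa> (p - k - 1) (q - (l - k)) x +
       of_nat (q - (l - k)) * \<kappa> i * bimonomial \<theta> \<kappa> (p - k) (q - (l - k) - 1) x)
    = \<theta> i * c k * E (Suc k) (l - k) + \<kappa> i * c k * E k (Suc (l - k))" for k
  proof -
    have "c k * ffact p k * ffact q (l - k) *
      (of_nat (p - k) * \<theta> i * bimonomial \<theta> \<kappa> (p - k - 1) (q - (l - k)) x +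
       of_nat (q - (l - k)) * \<kappa> i * bimonomial \<theta> \<kappa> (p - k) (q - (l - k) - 1) x)
     = \<theta> i * c k * ((ffact p k * of_nat (p - k)) * ffact q (l - k) * bimonomial \<theta> \<kappa> (p - k - 1) (q - (l - k)) x)
     + \<kappa> i * c k * (ffact p k * (ffact q (l - k) * of_nat (q - (l - k))) * bimonomial \<theta> \<kappa> (p - k) (q - (l - k) - 1) x)"
      by (simp add: algebra_simps)
    then show ?thesis unfolding ffact_mult_of_nat_diff E_def by (simp add: diff_diff_left)
  qed
  have "((\<lambda>t. \<Sum>k\<le>l. c k * ffact p k * ffact q (l - k) * bimonomial \<theta> \<kappa> (p - k) (q - (l - k)) (x + t *\<^sub>R axis i 1))
     has_vector_derivative (\<Sum>k\<le>l. \<theta> i * c k * E (Suc k) (l - k) + \<kappa> i * c k * E k (Suc (l - k)))) (at 0)"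
    unfolding trm[symmetric]
    by (intro has_vector_derivative_sum has_vector_derivative_mult_right bimonomial_has_vector_derivative)
  also have "(\<Sum>k\<le>l. \<theta> i * c k * E (Suc k) (l - k) + \<kappa> i * c k * E k (Suc (l - k)))
     = (\<Sum>k\<le>l. \<theta> i * c k * E (Suc k) (l - k)) + (\<Sum>k\<le>Suc l. \<kappa> i * c k * E k (Suc l - k))"
    by (simp add: sum.distrib c0 Suc_diff_le)
  also have "(\<Sum>k\<le>l. \<theta> i * c k * E (Suc k) (l - k))
     = (\<Sum>k\<le>Suc l. (case k of 0 \<Rightarrow> 0 | Suc k \<Rightarrow> \<theta> i * c k) * E k (Suc l - k))"
    by (subst sum.atMost_Suc_shift) simp
  also have "\<dots> + (\<Sum>k\<le>Suc l. \<kappa> i * c k * E k (Suc l - k)) = bimonomial_deriv \<theta> \<kappa> p q (i # is) x"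
    unfolding bimonomial_deriv_def sum.distrib[symmetric] coeff_dpoly_Cons
    by (intro sum.cong) (auto simp: l_def c_def E_def algebra_simps split: nat.split)
  finally show ?thesis by (simp add: bimonomial_deriv_def l_def c_def)
qed

lemma Dpart_bimonomial: "Dpart is (bimonomial \<theta> \<kappa> p q) = bimonomial_deriv \<theta> \<kappa> p q is"
proof (induction "is")
  case Nil
  show ?case by (auto simp: bimonomial_deriv_def dpoly_def)
next
  case (Cons i "is")
  show ?case
    by (auto simp: Cons intro!: vector_derivative_at bimonomial_deriv_has_vector_derivative)
qed

lemma smooth_on_bimonomial: "smooth_on S (bimonomial \<theta> \<kappa> p q)"
  unfolding smooth_on_def Dpart_bimonomial
  by (auto intro: bimonomial_deriv_has_vector_derivative)
     (auto simp: bimonomial_deriv_def[abs_def] intro!: continuous_intros)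

text \<open>By nullity, the sum over \<open>j\<close> of
  \<open>(\<kappa> j + \<theta> j X)^2\<close> is \<open>c X\<close>, so the \<open>m\<close>-th
  power of the Laplacian has generating polynomial \<open>c^m X^m\<close>. Exactly \<open>m\<close>
  derivatives hit each factor, which kills the product if one exponent is below
  \<open>m\<close>.\<close>

lemma polyharmonic_bimonomial:
  fixes \<theta> \<kappa> :: "'n::finite \<Rightarrow> complex"
  assumes null: "(\<Sum>i\<in>UNIV. \<theta> i * \<theta> i) = 0" "(\<Sum>i\<in>UNIV. \<kappa> i * \<kappa> i) = 0" and "p < m \<or> q < m"
  shows "(\<Sum>js\<in>{js::'n list. length js = m}. bimonomial_deriv \<theta> \<kappa> p q (concat (map (\<lambda>j. [j, j]) js)) x) = 0"
proof -
  define c where "c = (\<Sum>i\<in>UNIV. 2 * \<theta> i * \<kappa> i)"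
  have len: "length (concat (map (\<lambda>j. [j, j]) js)) = 2 * length js" for js :: "'n list"
    by (induction js) auto
  have dp: "dpoly \<theta> \<kappa> (concat (map (\<lambda>j. [j, j]) js)) = prod_list (map (\<lambda>j. [:\<kappa> j, \<theta> j:] * [:\<kappa> j, \<theta> j:]) js)" for js
    by (induction js) (simp_all add: dpoly_def mult.assoc del: mult_pCons_left mult_pCons_right)
  have "(\<Sum>j\<in>UNIV. [:\<kappa> j, \<theta> j:] * [:\<kappa> j, \<theta> j:]) = monom c 1"
  proof (rule poly_eqI)
    fix k
    show "coeff (\<Sum>j\<in>UNIV. [:\<kappa> j, \<theta> j:] * [:\<kappa> j, \<theta> j:]) k = coeff (monom c 1) k"
    proof -
      consider "k = 0" | "k = 1" | "k = 2" | k' where "k = Suc (Suc (Suc k'))"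
        by (metis One_nat_def Suc_1 not0_implies_Suc)
      then show ?thesis
        using null by cases (auto simp: coeff_sum c_def algebra_simps numeral_2_eq_2)
    qed
  qed
  then have sum_dp: "(\<Sum>js\<in>{js::'n list. length js = m}. dpoly \<theta> \<kappa> (concat (map (\<lambda>j. [j, j]) js))) = monom (c ^ m) m"
    unfolding dp sum_lists_prod_list by (simp add: monom_power)
  have "(\<Sum>js\<in>{js::'n list. length js = m}. bimonomial_deriv \<theta> \<kappa> p q (concat (map (\<lambda>j. [j, j]) js)) x)
     = (\<Sum>js\<in>{js::'n list. length js = m}. \<Sum>k\<le>2*m. coeff (dpoly \<theta> \<kappa> (concat (map (\<lambda>j. [j, j]) js))) k *
         (ffact p k * ffact q (2*m - k) * bimonomial \<theta> \<kappa> (p - k) (q - (2*m - k)) x))"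
    by (intro sum.cong refl) (auto simp: bimonomial_deriv_def len mult_ac)
  also have "\<dots> = (\<Sum>k\<le>2*m. coeff (monom (c ^ m) m) k *
         (ffact p k * ffact q (2*m - k) * bimonomial \<theta> \<kappa> (p - k) (q - (2*m - k)) x))"
    unfolding sum_dp[symmetric] coeff_sum sum_distrib_right by (rule sum.swap)
  also have "\<dots> = 0"
  proof (rule sum.neutral, safe)
    fix k
    show "coeff (monom (c ^ m) m) k *
         (ffact p k * ffact q (2*m - k) * bimonomial \<theta> \<kappa> (p - k) (q - (2*m - k)) x) = 0"
      using assms(3) by (cases "k = m") (auto simp: ffact_eq_0)
  qed
  finally show ?thesis .
qed

section \<open>Weak derivatives of smooth functions\<close>

text \<open>The complement of the support is open, so each difference quotient there eventually
  involves zeros only.\<close>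

lemma Dpart_eq_0_outside_support:
  assumes "x \<notin> closure {x. f x \<noteq> 0}"
  shows "Dpart is f x = 0"
  using assms
proof (induction "is" arbitrary: x)
  case Nil
  then have "x \<notin> {x. f x \<noteq> 0}" using subsetD[OF closure_subset] by (rule contrapos_nn)
  then show ?case by simp
next
  case (Cons i "is")
  let ?U = "- closure {x. f x \<noteq> 0}"
  have "continuous (at 0) (\<lambda>t::real. x + t *\<^sub>R axis i 1)" by (intro continuous_intros)
  then have "((\<lambda>t::real. x + t *\<^sub>R axis i 1) \<longlongrightarrow> x) (at 0)" by (simp add: continuous_within)
  moreover have "open ?U" "x \<in> ?U" using Cons.prems by auto
  ultimately have "eventually (\<lambda>t. x + t *\<^sub>R axis i 1 \<in> ?U) (at 0)" by (rule topological_tendstoD)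
  then have "eventually (\<lambda>t. Dpart is f (x + t *\<^sub>R axis i 1) = 0) (at 0)"
    by eventually_elim (use Cons.IH in auto)
  then have "eventually (\<lambda>t. Dpart is f (x + t *\<^sub>R axis i 1) = 0) (nhds 0)"
    using Cons.IH[OF Cons.prems] by (auto simp: eventually_nhds_conv_at)
  then have "((\<lambda>t. Dpart is f (x + t *\<^sub>R axis i 1)) has_vector_derivative 0) (at 0)"
    using has_vector_derivative_cong_ev[where S = UNIV and x = 0 and f = "\<lambda>t. Dpart is f (x + t *\<^sub>R axis i 1)" and g = "\<lambda>_. 0" and f' = 0]
      Cons.IH[OF Cons.prems] by (auto elim: eventually_mono)
  then show ?case by (simp add: vector_derivative_at)
qed

lemma has_vector_derivative_line:
  fixes f :: "'a::real_vector \<Rightarrow> 'b::real_normed_vector"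
  assumes "\<And>x. ((\<lambda>t. f (x + t *\<^sub>R v)) has_vector_derivative f' x) (at 0)"
  shows "((\<lambda>t. f (x + t *\<^sub>R v)) has_vector_derivative f' (x + s *\<^sub>R v)) (at s)"
proof -
  have "((\<lambda>t. f ((x + s *\<^sub>R v) + (t - s) *\<^sub>R v)) has_vector_derivative f' (x + s *\<^sub>R v)) (at s)"
  proof -
    have "((\<lambda>t. t - s) has_vector_derivative 1 - 0) (at s)"
      by (intro has_vector_derivative_diff has_vector_derivative_id has_vector_derivative_const)
    then show ?thesis
      using assms[of "x + s *\<^sub>R v"]
        vector_diff_chain_at[of "\<lambda>t. t - s" 1 s "\<lambda>t. f ((x + s *\<^sub>R v) + t *\<^sub>R v)" "f' (x + s *\<^sub>R v)"]
      by (simp add: o_def)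
  qed
  moreover have "(x + s *\<^sub>R v) + (t - s) *\<^sub>R v = x + t *\<^sub>R v" for t
    by (simp add: scaleR_diff_left)
  ultimately show ?thesis by simp
qed

text \<open>Translation invariance makes the integrals of all difference quotients vanish.\<close>

lemma lborel_integral_directional_derivative_eq_0:
  fixes f :: "real^'n::finite \<Rightarrow> complex"
  assumes cont: "continuous_on UNIV f" "continuous_on UNIV f'"
    and deriv: "\<And>x. ((\<lambda>t. f (x + t *\<^sub>R v)) has_vector_derivative f' x) (at 0)"
    and K: "compact K" and zero: "\<And>x. x \<notin> K \<Longrightarrow> f x = 0" "\<And>x. x \<notin> K \<Longrightarrow> f' x = 0"
  shows "(\<integral>x. f' x \<partial>lborel) = 0"
proof -
  define h where "h n = inverse (real (Suc n))" for n
  have h: "h n > 0" "h n \<le> 1" for n by (auto simp: h_def field_simps)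
  \<comment> \<open>Contains the support of every translate \<open>f (x + t v)\<close> with
    \<open>t\<close> in the unit interval. All difference quotients thus vanish off the single
    compact set \<open>K \<union> K'\<close>, which provides the dominating function.\<close>
  define K' where "K' = {x - t *\<^sub>R v |x t. x \<in> K \<and> t \<in> {0..1}}"
  have K': "compact K'"
  proof -
    have "K' = (\<lambda>(x, t). x - t *\<^sub>R v) ` (K \<times> {0..1})" unfolding K'_def by force
    then show ?thesis using K by (auto intro!: compact_continuous_image compact_Times continuous_intros simp: case_prod_unfold)
  qed
  obtain B where B: "\<And>x. norm (f' x) \<le> B"
  proof -
    have "bounded (f' ` K)" using K cont(2)
      by (intro compact_imp_bounded compact_continuous_image) (auto intro: continuous_on_subset)
    then obtain B where "\<forall>x\<in>K. norm (f' x) \<le> B" unfolding bounded_iff by auto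
    then have "norm (f' x) \<le> max B 0" for x using zero(2)[of x] by (cases "x \<in> K") auto
    then show ?thesis using that by blast
  qed
  have fint: "integrable lborel f"
  proof -
    have "integrable lborel (\<lambda>x. indicator K x *\<^sub>R f x)"
      using K cont(1) by (intro borel_integrable_compact) (auto intro: continuous_on_subset)
    moreover have "(\<lambda>x. indicator K x *\<^sub>R f x) = f" using zero(1) by (auto simp: indicator_def fun_eq_iff)
    ultimately show ?thesis by simp
  qed
  define s where "s n x = (f (x + h n *\<^sub>R v) - f x) /\<^sub>R h n" for n x
  have shift: "(\<integral>x. f (x + c) \<partial>lborel) = (\<integral>x. f x \<partial>lborel)" "integrable lborel (\<lambda>x. f (x + c))" for c
  proof -
    have m: "f \<in> borel_measurable borel" using cont(1) by (rule borel_measurable_continuous_onI)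
    have "(\<integral>x. f x \<partial>lborel) = (\<integral>x. f x \<partial>distr lborel borel ((+) c))" by (simp add: lborel_distr_plus)
    also have "\<dots> = (\<integral>x. f (c + x) \<partial>lborel)" using m by (subst integral_distr) auto
    finally show "(\<integral>x. f (x + c) \<partial>lborel) = (\<integral>x. f x \<partial>lborel)" by (simp add: add.commute)
    have "integrable (distr lborel borel ((+) c)) f" using fint by (simp add: lborel_distr_plus)
    then show "integrable lborel (\<lambda>x. f (x + c))" using m by (subst (asm) integrable_distr_eq) (auto simp: add.commute)
  qed
  have "(\<integral>x. s n x \<partial>lborel) = 0" for n
    using shift[of "h n *\<^sub>R v"] fint by (simp add: s_def)
  moreover have "(\<lambda>n. \<integral>x. s n x \<partial>lborel) \<longlonglongrightarrow> (\<integral>x. f' x \<partial>lborel)"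
  proof (rule integral_dominated_convergence[where w = "\<lambda>x. indicator (K \<union> K') x *\<^sub>R B"])
    show "f' \<in> borel_measurable lborel"
      using cont(2) by (simp add: borel_measurable_continuous_onI)
    show "s n \<in> borel_measurable lborel" for n
      unfolding s_def using fint shift(2)[of "h n *\<^sub>R v"] by (intro borel_measurable_scaleR borel_measurable_diff) auto
    show "integrable lborel (\<lambda>x. indicator (K \<union> K') x *\<^sub>R B)"
      using K K' by (intro borel_integrable_compact) (auto intro: compact_Un)
    show "AE x in lborel. (\<lambda>n. s n x) \<longlonglongrightarrow> f' x"
    proof (rule AE_I2)
      fix x
      have "((\<lambda>t. (f (x + t *\<^sub>R v) - f x) /\<^sub>R t) \<longlongrightarrow> f' x) (at 0)"
      proof (rule LIM_zero_cancel, rule tendsto_norm_zero_cancel)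
        have "((\<lambda>t. norm (f (x + t *\<^sub>R v) - f x - t *\<^sub>R f' x) / norm t) \<longlongrightarrow> 0) (at 0)"
          using deriv[of x] by (simp add: has_vector_derivative_def has_derivative_at)
        moreover have "\<forall>\<^sub>F t in at (0::real). norm (f (x + t *\<^sub>R v) - f x - t *\<^sub>R f' x) / norm t
            = norm ((f (x + t *\<^sub>R v) - f x) /\<^sub>R t - f' x)"
          unfolding eventually_at_filter
        proof (rule always_eventually, safe)
          fix t :: real assume "t \<noteq> 0"
          then have "(f (x + t *\<^sub>R v) - f x) /\<^sub>R t - f' x = (f (x + t *\<^sub>R v) - f x - t *\<^sub>R f' x) /\<^sub>R t"
            by (simp add: scaleR_diff_right)
          then show "norm (f (x + t *\<^sub>R v) - f x - t *\<^sub>R f' x) / norm t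
            = norm ((f (x + t *\<^sub>R v) - f x) /\<^sub>R t - f' x)" by (simp add: divide_inverse mult.commute)
        qed
        ultimately show "((\<lambda>t. norm ((f (x + t *\<^sub>R v) - f x) /\<^sub>R t - f' x)) \<longlongrightarrow> 0) (at 0)"
          by (rule Lim_transform_eventually)
      qed
      moreover have "filterlim h (at 0) sequentially"
        unfolding filterlim_at h_def using LIMSEQ_inverse_real_of_nat by auto
      ultimately show "(\<lambda>n. s n x) \<longlonglongrightarrow> f' x"
        unfolding s_def by (rule filterlim_compose)
    qed
    show "AE x in lborel. norm (s n x) \<le> indicator (K \<union> K') x *\<^sub>R B" for n
    proof (rule AE_I2)
      fix x
      have "norm (f (x + h n *\<^sub>R v) - f (x + 0 *\<^sub>R v)) \<le> B * norm (h n - 0)"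
      proof (rule differentiable_bound[of UNIV "\<lambda>t. f (x + t *\<^sub>R v)" "\<lambda>s t. t *\<^sub>R f' (x + s *\<^sub>R v)"])
        show "((\<lambda>t. f (x + t *\<^sub>R v)) has_derivative (\<lambda>t. t *\<^sub>R f' (x + s *\<^sub>R v))) (at s)" for s
          using has_vector_derivative_line[OF deriv, of x s] by (simp add: has_vector_derivative_def)
        show "onorm (\<lambda>t. t *\<^sub>R f' (x + s *\<^sub>R v)) \<le> B" for s
          using B[of "x + s *\<^sub>R v"] by (intro onorm_le) (simp add: mult.commute[of B] mult_left_mono)
      qed auto
      then have "norm (f (x + h n *\<^sub>R v) - f x) / h n \<le> B"
        using h[of n] by (simp add: pos_divide_le_eq)
      then have "norm (s n x) \<le> B"
        using h[of n] by (simp add: s_def divide_inverse mult.commute)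
      moreover have "s n x = 0" if "x \<notin> K \<union> K'"
      proof -
        have "x + h n *\<^sub>R v \<notin> K"
        proof
          assume "x + h n *\<^sub>R v \<in> K"
          then have "(x + h n *\<^sub>R v) - h n *\<^sub>R v \<in> K'" unfolding K'_def using h[of n] by fastforce
          then show False using that by simp
        qed
        then show ?thesis using zero(1) that by (simp add: s_def)
      qed
      ultimately show "norm (s n x) \<le> indicator (K \<union> K') x *\<^sub>R B"
        by (cases "x \<in> K \<union> K'") auto
    qed
  qed
  ultimately have "(\<lambda>n. 0) \<longlonglongrightarrow> (\<integral>x. f' x \<partial>lborel)" by simp
  then show ?thesis by (simp add: LIMSEQ_const_iff)
qed

lemma smooth_on_UNIV_continuous: "smooth_on UNIV f \<Longrightarrow> continuous_on S (Dpart is f)"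
  unfolding smooth_on_def using continuous_on_subset by blast

lemma smooth_on_UNIV_derivative:
  "smooth_on UNIV f \<Longrightarrow> ((\<lambda>t. Dpart is f (x + t *\<^sub>R axis i 1)) has_vector_derivative Dpart (i # is) f x) (at 0)"
  unfolding smooth_on_def by blast

text \<open>Derivatives move to \<open>u\<close> one at a time, the outermost first, and therefore
  arrive in reversed order. The accumulator \<open>js\<close> makes the induction go through without
  interchanging partial derivatives.\<close>

lemma lborel_integration_by_parts:
  fixes u \<phi> :: "real^'n::finite \<Rightarrow> complex"
  assumes u: "smooth_on UNIV u" and \<phi>: "test_function \<Omega> \<phi>"
  shows "(\<integral>x. Dpart js u x * Dpart is \<phi> x \<partial>lborel)
    = (-1) ^ length is * (\<integral>x. Dpart (rev is @ js) u x * \<phi> x \<partial>lborel)"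
proof (induction "is" arbitrary: js)
  case (Cons i "is")
  define K where "K = closure {x. \<phi> x \<noteq> 0}"
  have K: "compact K" and s\<phi>: "smooth_on UNIV \<phi>" using \<phi> by (auto simp: test_function_def K_def)
  have z: "Dpart ks \<phi> x = 0" if "x \<notin> K" for ks x
    using that unfolding K_def by (rule Dpart_eq_0_outside_support)
  have int: "integrable lborel (\<lambda>x. Dpart ks u x * Dpart ls \<phi> x)" for ks ls
  proof -
    have "integrable lborel (\<lambda>x. indicator K x *\<^sub>R (Dpart ks u x * Dpart ls \<phi> x))"
      using K by (intro borel_integrable_compact continuous_intros smooth_on_UNIV_continuous u s\<phi>) 
    moreover have "(\<lambda>x. indicator K x *\<^sub>R (Dpart ks u x * Dpart ls \<phi> x)) = (\<lambda>x. Dpart ks u x * Dpart ls \<phi> x)"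
      using z by (auto simp: indicator_def fun_eq_iff)
    ultimately show ?thesis by simp
  qed
  have "(\<integral>x. (Dpart js u x * Dpart (i # is) \<phi> x + Dpart (i # js) u x * Dpart is \<phi> x) \<partial>lborel) = 0"
  proof (rule lborel_integral_directional_derivative_eq_0[where K = K and v = "axis i 1" and f = "\<lambda>x. Dpart js u x * Dpart is \<phi> x"])
    show "((\<lambda>t. Dpart js u (x + t *\<^sub>R axis i 1) * Dpart is \<phi> (x + t *\<^sub>R axis i 1)) has_vector_derivative
        Dpart js u x * Dpart (i # is) \<phi> x + Dpart (i # js) u x * Dpart is \<phi> x) (at 0)" for x
      using has_vector_derivative_mult[OF smooth_on_UNIV_derivative[OF u, of js x i] smooth_on_UNIV_derivative[OF s\<phi>, of "is" x i]]
      by simp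
  qed (intro K continuous_intros smooth_on_UNIV_continuous u s\<phi> | simp add: z del: Dpart.simps)+
  then have "(\<integral>x. Dpart js u x * Dpart (i # is) \<phi> x \<partial>lborel) = - (\<integral>x. Dpart (i # js) u x * Dpart is \<phi> x \<partial>lborel)"
    using int by (simp add: add_eq_0_iff2 del: Dpart.simps)
  also have "\<dots> = (-1) ^ length (i # is) * (\<integral>x. Dpart (rev (i # is) @ js) u x * \<phi> x \<partial>lborel)"
    by (simp only: Cons.IH) simp
  finally show ?case .
qed simp

section \<open>Smooth bump functions on boxes\<close>

definition flat :: "nat \<Rightarrow> real \<Rightarrow> real" where
  "flat k y = (if y > 0 then exp (- 1 / y) / y ^ k else 0)"

lemma flat_Suc: "y * flat (Suc k) y = flat k y"
  by (auto simp: flat_def)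

lemma flat_tendsto_0: "(flat k \<longlongrightarrow> 0) (at 0)"
proof -
  have "((\<lambda>y::real. inverse y ^ k / exp (inverse y)) \<longlongrightarrow> 0) (at_right 0)"
    by (rule filterlim_compose[OF tendsto_power_div_exp_0 filterlim_inverse_at_top_right])
  moreover have "eventually (\<lambda>y. inverse y ^ k / exp (inverse y) = flat k y) (at_right 0)"
    unfolding eventually_at_filter by (auto simp: flat_def exp_minus field_simps)
  ultimately have "(flat k \<longlongrightarrow> 0) (at_right 0)" by (rule Lim_transform_eventually)
  moreover have "(flat k \<longlongrightarrow> 0) (at_left 0)"
    by (rule tendsto_eventually) (auto simp: eventually_at_filter flat_def)
  ultimately show ?thesis by (simp add: filterlim_split_at)
qed

text \<open>The powers in the denominator are there to make the family closed under differentiation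
  up to linear combinations. At \<open>y = 0\<close> the difference quotient of
  \<open>flat k\<close> is \<open>flat (Suc k)\<close>, which tends to zero.\<close>

lemma flat_has_real_derivative:
  "(flat k has_real_derivative flat (k + 2) y - of_nat k * flat (k + 1) y) (at y)"
proof -
  consider "y < 0" | "y = 0" | "y > 0" by linarith
  then show ?thesis
  proof cases
    case 1
    have "((\<lambda>_. 0) has_real_derivative 0) (at y)" by simp
    moreover have "eventually (\<lambda>z. flat k z = 0) (nhds y)"
      using eventually_nhds_in_open[of "{..<0}" y] 1 by (auto simp: flat_def elim: eventually_mono)
    ultimately show ?thesis using 1 by (subst DERIV_cong_ev[OF refl _ refl]) (auto simp: flat_def)
  next
    case 2
    have "((\<lambda>h. (flat k (0 + h) - flat k 0) / h) \<longlongrightarrow> 0) (at 0)"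
    proof (rule Lim_transform_eventually[OF flat_tendsto_0[of "Suc k"]])
      show "eventually (\<lambda>h. flat (Suc k) h = (flat k (0 + h) - flat k 0) / h) (at 0)"
        unfolding eventually_at_filter
        by (rule always_eventually) (auto simp: flat_def field_simps)
    qed
    then show ?thesis using 2 by (simp add: DERIV_def flat_def[of _ 0])
  next
    case 3
    have "((\<lambda>y. exp (- 1 / y) / y ^ k) has_real_derivative flat (k + 2) y - of_nat k * flat (k + 1) y) (at y)"
    proof (cases "k = 0")
      case False
      then have "y ^ k = y * y ^ (k - 1)" by (simp add: power_eq_if)
      then show ?thesis
        using 3 by (auto intro!: derivative_eq_intros simp: flat_def field_simps power2_eq_square)
    qed (use 3 in \<open>auto intro!: derivative_eq_intros simp: flat_def field_simps power2_eq_square\<close>)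
    moreover have "eventually (\<lambda>z. flat k z = exp (- 1 / z) / z ^ k) (nhds y)"
      using eventually_nhds_in_open[of "{0<..}" y] 3 by (auto simp: flat_def elim: eventually_mono)
    ultimately show ?thesis by (subst DERIV_cong_ev[OF refl _ refl]) auto
  qed
qed

text \<open>The polynomial factor in the \<open>j\<close>-th derivative of \<open>flat 0\<close>
  composed with \<open>q\<close>, normalized so that the other factor is always
  \<open>flat (2 * j)\<close>; \<open>flat_Suc\<close> brings all terms to this common
  index.\<close>

fun bump_poly :: "real poly \<Rightarrow> nat \<Rightarrow> real poly" where
  "bump_poly q 0 = 1"
| "bump_poly q (Suc j) = pderiv (bump_poly q j) * q * q + bump_poly q j * pderiv q
     - of_nat (2 * j) * bump_poly q j * pderiv q * q"

definition bump_deriv :: "real poly \<Rightarrow> nat \<Rightarrow> real \<Rightarrow> real" where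
  "bump_deriv q j t = poly (bump_poly q j) t * flat (2 * j) (poly q t)"

lemma bump_deriv_has_real_derivative:
  "(bump_deriv q j has_real_derivative bump_deriv q (Suc j) t) (at t)"
proof -
  let ?P = "bump_poly q j" and ?y = "poly q t" and ?k = "2 * j"
  have "((\<lambda>t. flat ?k (poly q t)) has_real_derivative
      (flat (?k + 2) ?y - of_nat ?k * flat (?k + 1) ?y) * poly (pderiv q) t) (at t)"
    by (rule DERIV_chain2[OF flat_has_real_derivative poly_DERIV])
  from DERIV_mult[OF poly_DERIV[of ?P t] this]
  have "(bump_deriv q j has_real_derivative
      poly (pderiv ?P) t * flat ?k ?y +
      (flat (?k + 2) ?y - of_nat ?k * flat (?k + 1) ?y) * poly (pderiv q) t * poly ?P t) (at t)"
    by (simp add: bump_deriv_def[abs_def])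
  moreover have "flat ?k ?y = ?y * (?y * flat (?k + 2) ?y)" "flat (?k + 1) ?y = ?y * flat (?k + 2) ?y"
    using flat_Suc[of ?y ?k] flat_Suc[of ?y "Suc ?k"] by auto
  ultimately have "(bump_deriv q j has_real_derivative
      poly (pderiv ?P) t * (?y * (?y * flat (?k + 2) ?y)) +
      (flat (?k + 2) ?y - of_nat ?k * (?y * flat (?k + 2) ?y)) * poly (pderiv q) t * poly ?P t) (at t)"
    by simp
  also have "poly (pderiv ?P) t * (?y * (?y * flat (?k + 2) ?y)) +
      (flat (?k + 2) ?y - of_nat ?k * (?y * flat (?k + 2) ?y)) * poly (pderiv q) t * poly ?P t
      = bump_deriv q (Suc j) t"
    by (simp add: bump_deriv_def of_nat_poly algebra_simps)
  finally show ?thesis .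
qed

text \<open>A tensor product of one-dimensional bumps, with its derivatives of all orders given
  explicitly because \<open>smooth_on\<close> refers to every index list. Only the multiplicity of
  each index matters.\<close>

definition box_bump_deriv :: "('n::finite \<Rightarrow> real poly) \<Rightarrow> 'n list \<Rightarrow> real^'n \<Rightarrow> complex" where
  "box_bump_deriv Q is x = of_real (\<Prod>i\<in>UNIV. bump_deriv (Q i) (count_list is i) (x $ i))"

lemma box_bump_deriv_has_vector_derivative:
  fixes Q :: "'n::finite \<Rightarrow> real poly"
  shows "((\<lambda>t. box_bump_deriv Q is (x + t *\<^sub>R axis i 1)) has_vector_derivative box_bump_deriv Q (i # is) x) (at 0)"
proof -
  let ?R = "\<Prod>j\<in>UNIV - {i}. bump_deriv (Q j) (count_list is j) (x $ j)"
  let ?c = "count_list is i"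
  have "((\<lambda>t. bump_deriv (Q i) ?c (x $ i + t)) has_real_derivative bump_deriv (Q i) (Suc ?c) (x $ i)) (at 0)"
    using bump_deriv_has_real_derivative[of "Q i" ?c "x $ i"] DERIV_shift[of "bump_deriv (Q i) ?c" _ 0 "x $ i"]
    by (simp add: add.commute)
  then have "((\<lambda>t. bump_deriv (Q i) ?c (x $ i + t) * ?R) has_real_derivative bump_deriv (Q i) (Suc ?c) (x $ i) * ?R) (at 0)"
    by (rule DERIV_cmult_right)
  then have "((\<lambda>t. complex_of_real (bump_deriv (Q i) ?c (x $ i + t) * ?R)) has_vector_derivative
      of_real (bump_deriv (Q i) (Suc ?c) (x $ i) * ?R)) (at 0)"
    by (rule has_vector_derivative_of_real)
  moreover have "box_bump_deriv Q is (x + t *\<^sub>R axis i 1) = of_real (bump_deriv (Q i) ?c (x $ i + t) * ?R)" for t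
    unfolding box_bump_deriv_def by (subst prod.remove[of UNIV i]) (auto simp: axis_def intro!: prod.cong)
  moreover have "box_bump_deriv Q (i # is) x = of_real (bump_deriv (Q i) (Suc ?c) (x $ i) * ?R)"
    unfolding box_bump_deriv_def by (subst prod.remove[of UNIV i]) (auto intro!: prod.cong)
  ultimately show ?thesis by simp
qed

lemma Dpart_box_bump: "Dpart is (box_bump_deriv Q []) = box_bump_deriv Q is"
proof (induction "is")
  case (Cons i "is")
  show ?case
    by (auto simp: Cons intro!: vector_derivative_at box_bump_deriv_has_vector_derivative)
qed simp

lemma smooth_on_box_bump:
  fixes Q :: "'n::finite \<Rightarrow> real poly"
  shows "smooth_on UNIV (box_bump_deriv Q [])"
proof -
  have "continuous_on UNIV (bump_deriv q j)" for q j
    using bump_deriv_has_real_derivative DERIV_isCont continuous_at_imp_continuous_on by blast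
  then have "continuous_on UNIV (\<lambda>x::real^'n. bump_deriv (Q i) j (x $ i))" for i j
    by (rule continuous_on_compose2) (auto intro!: continuous_intros)
  then have "continuous_on UNIV (box_bump_deriv Q is)" for "is"
    unfolding box_bump_deriv_def[abs_def] by (intro continuous_intros)
  then show ?thesis
    unfolding smooth_on_def Dpart_box_bump by (auto intro: box_bump_deriv_has_vector_derivative)
qed

text \<open>In each coordinate the polynomial is \<open>N (t - a_i) (b_i - t)\<close>. Over a
  nonempty box it is positive just inside the interval when \<open>N > 0\<close>, and it tends to
  infinity there as \<open>N\<close> grows, so the bump tends to one.\<close>

definition box_bump :: "nat \<Rightarrow> real^'n::finite \<Rightarrow> real^'n \<Rightarrow> real^'n \<Rightarrow> complex" where
  "box_bump N a b = box_bump_deriv (\<lambda>i. smult (real N) ([:- (a $ i), 1:] * [:b $ i, -1:])) []"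

lemma box_bump_altdef:
  "box_bump N a b x = of_real (\<Prod>i\<in>UNIV. flat 0 (real N * ((x $ i - a $ i) * (b $ i - x $ i))))"
  by (simp add: box_bump_def box_bump_deriv_def bump_deriv_def algebra_simps)

text \<open>Nonemptiness of the box gives \<open>a $ i < b $ i\<close>; otherwise both factors of
  the quadratic could be negative and their product positive.\<close>

lemma box_bump_outside_box:
  assumes "box a b \<noteq> {}" "x \<notin> box a b"
  shows "box_bump N a b x = 0"
proof -
  obtain i where i: "x $ i \<le> a $ i \<or> b $ i \<le> x $ i" using assms(2) by (auto simp: mem_box_cart not_less)
  have "a $ i < b $ i" using assms(1) by (auto simp: interval_ne_empty_cart)
  then have "(x $ i - a $ i) * (b $ i - x $ i) \<le> 0" using i by (auto simp: mult_le_0_iff)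
  then have "flat 0 (real N * ((x $ i - a $ i) * (b $ i - x $ i))) = 0"
    using mult_nonneg_nonpos[of "real N"] by (simp add: flat_def not_less)
  then show ?thesis by (auto simp: box_bump_altdef intro!: prod_zero bexI[of _ i])
qed

lemma norm_box_bump_le_1: "norm (box_bump N a b x) \<le> 1"
  unfolding box_bump_altdef norm_of_real abs_prod by (rule prod_le_1) (auto simp: flat_def)

lemma box_bump_tendsto_indicator:
  assumes "box a b \<noteq> {}"
  shows "(\<lambda>N. box_bump N a b x) \<longlonglongrightarrow> indicator (box a b) x"
proof (cases "x \<in> box a b")
  case False
  then show ?thesis using box_bump_outside_box[OF assms] by simp
next
  case True
  have "(\<lambda>N. flat 0 (real N * y)) \<longlonglongrightarrow> 1" if "y > 0" for y
  proof -
    have "(\<lambda>N. exp (- (1 / y) * inverse (real N))) \<longlonglongrightarrow> exp (- (1 / y) * 0)"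
      by (intro tendsto_intros LIMSEQ_inverse_real_of_nat lim_inverse_n)
    moreover have "eventually (\<lambda>N. exp (- (1 / y) * inverse (real N)) = flat 0 (real N * y)) sequentially"
      using eventually_gt_at_top[of 0] by eventually_elim (use that in \<open>auto simp: flat_def field_simps\<close>)
    ultimately show ?thesis using Lim_transform_eventually by fastforce
  qed
  then have "(\<lambda>N. flat 0 (real N * ((x $ i - a $ i) * (b $ i - x $ i)))) \<longlonglongrightarrow> 1" for i
    using True by (auto simp: mem_box_cart)
  then have "(\<lambda>N. complex_of_real (\<Prod>i\<in>UNIV. flat 0 (real N * ((x $ i - a $ i) * (b $ i - x $ i)))))
      \<longlonglongrightarrow> of_real (\<Prod>i\<in>(UNIV :: 'a set). 1)"
    by (intro tendsto_intros)
  then show ?thesis using True by (simp add: box_bump_altdef)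
qed

lemma test_function_box_bump:
  assumes "box a b \<noteq> {}" "cbox a b \<subseteq> \<Omega>"
  shows "test_function \<Omega> (box_bump N a b)"
proof -
  have "{x. box_bump N a b x \<noteq> 0} \<subseteq> box a b" using box_bump_outside_box[OF assms(1)] by blast
  then have "{x. box_bump N a b x \<noteq> 0} \<subseteq> cbox a b" using box_subset_cbox by blast
  then have cl: "closure {x. box_bump N a b x \<noteq> 0} \<subseteq> cbox a b" by (rule closure_minimal) (rule closed_cbox)
  then have "bounded (closure {x. box_bump N a b x \<noteq> 0})" using bounded_cbox bounded_subset by blast
  then show ?thesis
    unfolding test_function_def using cl assms(2) smooth_on_box_bump
    by (auto simp: box_bump_def compact_eq_bounded_closed)
qed

section \<open>The fundamental lemma of the calculus of variations\<close>

text \<open>A Dynkin argument: open boxes form an intersection-stable generator of the Borel sets,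
  and \<open>total\<close> takes care of complements. Lebesgue sets differ from Borel sets by null
  sets only.\<close>

lemma set_integral_eq_0_of_boxes:
  fixes h :: "real^'n::finite \<Rightarrow> complex"
  assumes int: "integrable lebesgue h"
    and boxes: "\<And>a b. (\<integral>x. indicator (box a b) x *\<^sub>R h x \<partial>lebesgue) = 0"
    and total: "(\<integral>x. h x \<partial>lebesgue) = 0"
    and A: "A \<in> sets lebesgue"
  shows "(\<integral>x. indicator A x *\<^sub>R h x \<partial>lebesgue) = 0"
proof -
  have ii: "integrable lebesgue (\<lambda>x. indicator A x *\<^sub>R h x)" if "A \<in> sets lebesgue" for A
    using int that by (simp add: integrable_mult_indicator)
  have borel: "(\<integral>x. indicator B x *\<^sub>R h x \<partial>lebesgue) = 0" if "B \<in> sets borel" for B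
  proof -
    let ?G = "range (\<lambda>(a, b). box a b :: (real^'n) set)"
    have sb: "sigma_sets UNIV ?G = sets borel" by (subst borel_eq_box) simp
    have "Int_stable ?G"
      unfolding Int_stable_def by (auto simp: box_Int_box)
    moreover have "?G \<subseteq> Pow UNIV" by simp
    moreover have "B \<in> sigma_sets UNIV ?G" using that sb by simp
    ultimately show ?thesis
    proof (induction rule: sigma_sets_induct_disjoint)
      case (basic A)
      then show ?case using boxes by auto
    next
      case empty
      show ?case by simp
    next
      case (compl A)
      then have "A \<in> sets lebesgue"
        using sb by simp
      then have "(\<integral>x. h x - indicator A x *\<^sub>R h x \<partial>lebesgue) = 0"
        using int ii compl total by simp
      moreover have "(\<lambda>x. h x - indicator A x *\<^sub>R h x) = (\<lambda>x. indicator (UNIV - A) x *\<^sub>R h x)"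
        by (auto simp: indicator_def fun_eq_iff)
      ultimately show ?case by simp
    next
      case (union A)
      have m: "A i \<in> sets lebesgue" for i
        using union(2) sb range_subsetD by fastforce
      have "(LINT x:(\<Union>i. A i)|lebesgue. h x) = (\<Sum>i. (LINT x:(A i)|lebesgue. h x))"
        using union(1) m ii[of "\<Union>i. A i"]
        by (intro lebesgue_integral_countable_add) (auto simp: disjoint_family_on_def set_integrable_def)
      then show ?case using union by (simp add: set_lebesgue_integral_def)
    qed
  qed
  obtain S N where SN: "A = S \<union> N" "S \<in> sets lborel" "N \<in> null_sets lebesgue"
    using A by (metis sets_completionE null_sets_completion_subset null_sets_completionI subset_refl)
  have "(\<integral>x. indicator A x *\<^sub>R h x \<partial>lebesgue) = (\<integral>x. indicator S x *\<^sub>R h x \<partial>lebesgue)"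
  proof (rule integral_cong_AE)
    show "AE x in lebesgue. indicator A x *\<^sub>R h x = indicator S x *\<^sub>R h x"
      using AE_not_in[OF SN(3)] by eventually_elim (auto simp: SN(1) indicator_def)
  qed (use ii A SN in \<open>auto intro!: borel_measurable_integrable ii\<close>)
  then show ?thesis using borel[of S] SN(2) by simp
qed

text \<open>Bumps converge boundedly to the indicator of a box, so \<open>h\<close> integrates to
  zero over all boxes whose closed versions lie in \<open>\<Omega>\<close>. Dynkin's argument then
  passes to all measurable subsets of the given box.\<close>

lemma fundamental_lemma_box:
  fixes h :: "real^'n::finite \<Rightarrow> complex"
  assumes \<Omega>: "\<Omega> \<in> sets lebesgue" and int: "integrable (lebesgue_on \<Omega>) h"
    and test: "\<And>\<phi>. test_function \<Omega> \<phi> \<Longrightarrow> integral\<^sup>L (lebesgue_on \<Omega>) (\<lambda>x. h x * \<phi> x) = 0"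
    and cd: "cbox c d \<subseteq> \<Omega>"
  shows "AE x in lebesgue. x \<in> box c d \<longrightarrow> h x = 0"
proof -
  define h0 where "h0 x = indicator \<Omega> x *\<^sub>R h x" for x
  have h0: "integrable lebesgue h0"
    using int \<Omega> by (simp add: h0_def[abs_def] integrable_restrict_space)
  have box0: "(\<integral>x. indicator (box a b) x *\<^sub>R h0 x \<partial>lebesgue) = 0" if ab: "cbox a b \<subseteq> \<Omega>" for a b
  proof (cases "box a b = {}")
    case False
    have "(\<lambda>N. \<integral>x. box_bump N a b x * h0 x \<partial>lebesgue) \<longlonglongrightarrow> (\<integral>x. indicator (box a b) x * h0 x \<partial>lebesgue)"
    proof (rule integral_dominated_convergence[where w = "\<lambda>x. norm (h0 x)"])
      show "AE x in lebesgue. (\<lambda>N. box_bump N a b x * h0 x) \<longlonglongrightarrow> indicator (box a b) x * h0 x"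
        using box_bump_tendsto_indicator[OF False] by (auto intro!: tendsto_intros)
      show "AE x in lebesgue. norm (box_bump N a b x * h0 x) \<le> norm (h0 x)" for N
        using mult_right_mono[OF norm_box_bump_le_1 norm_ge_zero] by (intro AE_I2) (simp add: norm_mult)
      have "continuous_on UNIV (box_bump N a b)" for N
        using smooth_on_UNIV_continuous[OF smooth_on_box_bump, of UNIV "[]"]
        by (simp only: box_bump_def Dpart.simps(1))
      then have "box_bump N a b \<in> borel_measurable lborel" for N
        by (simp add: borel_measurable_continuous_onI)
      then have "box_bump N a b \<in> borel_measurable lebesgue" for N by (rule measurable_completion)
      then show "(\<lambda>x. box_bump N a b x * h0 x) \<in> borel_measurable lebesgue" for N
        using h0 by (intro borel_measurable_times) auto
      show "(\<lambda>x. indicator (box a b) x * h0 x) \<in> borel_measurable lebesgue"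
        using h0 by (intro borel_measurable_times borel_measurable_indicator) auto
    qed (use h0 in auto)
    moreover have "(\<integral>x. box_bump N a b x * h0 x \<partial>lebesgue) = 0" for N
      using test[OF test_function_box_bump[OF False ab], of N] \<Omega>
      by (simp add: integral_restrict_space h0_def mult_ac)
    ultimately have "(\<integral>x. indicator (box a b) x * h0 x \<partial>lebesgue) = 0" by (simp add: LIMSEQ_const_iff)
    moreover have "(\<lambda>x. indicator (box a b) x * h0 x) = (\<lambda>x. indicator (box a b) x *\<^sub>R h0 x)"
      by (auto simp: indicator_def)
    ultimately show ?thesis by simp
  qed simp
  \<comment> \<open>Cutting off at \<open>box c d\<close> reduces an arbitrary box to its
    intersection with \<open>box c d\<close>, where test functions are available.\<close>
  define h1 where "h1 x = indicator (box c d) x *\<^sub>R h0 x" for x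
  have h1: "integrable lebesgue h1"
    unfolding h1_def using h0 by (intro integrable_mult_indicator) auto
  have "AE x in lebesgue_on (cbox c d). h1 x = 0"
  proof (rule sigma_finite_measure.density_zero)
    show "sigma_finite_measure (lebesgue_on (cbox c d))"
      by (intro finite_measure.axioms(1) finite_measure_lebesgue_on) simp
    show "integrable (lebesgue_on (cbox c d)) h1"
      using h1 by (simp add: integrable_restrict_space integrable_mult_indicator)
    fix A assume A: "A \<in> sets (lebesgue_on (cbox c d))"
    then have A': "A \<in> sets lebesgue" "A \<subseteq> cbox c d" by (auto simp: sets_restrict_space)
    have "(\<integral>x. indicator A x *\<^sub>R h1 x \<partial>lebesgue) = 0"
    proof (rule set_integral_eq_0_of_boxes[OF h1 _ _ A'(1)])
      fix a b :: "real^'n"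
      obtain a' b' where ab': "box a b \<inter> box c d = box a' b'"
        using box_Int_box by blast
      show "(\<integral>x. indicator (box a b) x *\<^sub>R h1 x \<partial>lebesgue) = 0"
      proof (cases "box a' b' = {}")
        case True
        then have "(\<lambda>x. indicator (box a b) x *\<^sub>R h1 x) = (\<lambda>x. 0)"
          using ab' by (auto simp: h1_def indicator_def fun_eq_iff)
        then show ?thesis by simp
      next
        case False
        \<comment> \<open>\<open>box0\<close> asks for the closed box to lie in
          \<open>\<Omega>\<close>; for a nonempty open box it is the closure, hence contained in
          \<open>cbox c d\<close>.\<close>
        then have "closure (box a' b') = cbox a' b'" by (simp add: closure_box)
        moreover have "closure (box a' b') \<subseteq> closure (box c d)" using ab' by (intro closure_mono) blast
        moreover have "closure (box c d) \<subseteq> cbox c d" by (rule closure_minimal[OF box_subset_cbox closed_cbox])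
        ultimately have "cbox a' b' \<subseteq> \<Omega>" using cd by blast
        moreover have "(\<lambda>x. indicator (box a b) x *\<^sub>R h1 x) = (\<lambda>x. indicator (box a' b') x *\<^sub>R h0 x)"
          unfolding ab'[symmetric] by (auto simp: h1_def indicator_def fun_eq_iff)
        ultimately show ?thesis using box0 by simp
      qed
    next
      show "(\<integral>x. h1 x \<partial>lebesgue) = 0" unfolding h1_def using box0[OF cd] .
    qed
    moreover have "(\<lambda>x. indicator (cbox c d) x *\<^sub>R indicator A x *\<^sub>R h1 x) = (\<lambda>x. indicator A x *\<^sub>R h1 x)"
      using A'(2) by (auto simp: indicator_def fun_eq_iff)
    ultimately show "(LINT x:A|lebesgue_on (cbox c d). h1 x) = 0"
      by (simp add: set_lebesgue_integral_def integral_restrict_space)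
  qed
  then have "AE x in lebesgue. x \<in> cbox c d \<longrightarrow> h1 x = 0" by (simp add: AE_restrict_space_iff)
  then show ?thesis
    by eventually_elim (use cd box_subset_cbox in \<open>auto simp: h1_def h0_def subset_iff\<close>)
qed

text \<open>By Lindelof, countably many boxes with closed versions in \<open>\<Omega>\<close> cover
  \<open>\<Omega>\<close>, and a countable union of null sets is null.\<close>

lemma fundamental_lemma:
  fixes h :: "real^'n::finite \<Rightarrow> complex"
  assumes \<Omega>: "open \<Omega>" and int: "integrable (lebesgue_on \<Omega>) h"
    and test: "\<And>\<phi>. test_function \<Omega> \<phi> \<Longrightarrow> integral\<^sup>L (lebesgue_on \<Omega>) (\<lambda>x. h x * \<phi> x) = 0"
  shows "AE x in lebesgue_on \<Omega>. h x = 0"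
proof -
  define \<B> where "\<B> = {box c d | c d :: real^'n. cbox c d \<subseteq> \<Omega>}"
  have m: "\<Omega> \<in> sets lebesgue" using \<Omega> by simp
  obtain \<B>' where B': "\<B>' \<subseteq> \<B>" "countable \<B>'" "\<Union>\<B>' = \<Union>\<B>"
    using Lindelof[of \<B>] by (auto simp: \<B>_def open_box)
  have cover: "\<Omega> \<subseteq> \<Union>\<B>"
  proof
    fix x assume "x \<in> \<Omega>"
    then obtain c d where "x \<in> box c d" "cbox c d \<subseteq> \<Omega>"
      using open_contains_cbox[OF \<Omega>] by metis
    then show "x \<in> \<Union>\<B>" by (auto simp: \<B>_def)
  qed
  have "AE x in lebesgue. \<forall>B\<in>\<B>'. x \<in> B \<longrightarrow> h x = 0"
  proof (rule AE_ball_countable'[OF _ B'(2)])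
    fix B assume "B \<in> \<B>'"
    then obtain c d where "B = box c d" "cbox c d \<subseteq> \<Omega>" using B'(1) by (auto simp: \<B>_def)
    then show "AE x in lebesgue. x \<in> B \<longrightarrow> h x = 0" using fundamental_lemma_box[OF m int test] by simp
  qed
  then have "AE x in lebesgue. x \<in> \<Omega> \<longrightarrow> h x = 0"
  proof eventually_elim
    case (elim x)
    show ?case
    proof
      assume "x \<in> \<Omega>"
      then have "x \<in> \<Union>\<B>'" using cover B'(3) by auto
      then show "h x = 0" using elim by auto
    qed
  qed
  then show ?thesis using m by (simp add: AE_restrict_space_iff)
qed

section \<open>Classical derivatives as weak derivatives on bounded open sets\<close>

lemma integrable_on_bounded_open:
  fixes f :: "real^'n::finite \<Rightarrow> complex"
  assumes "open \<Omega>" "bounded \<Omega>" "continuous_on (closure \<Omega>) f"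
  shows "integrable (lebesgue_on \<Omega>) f"
proof -
  have "\<Omega> \<in> lmeasurable" using assms(1,2) by (simp add: bounded_set_imp_lmeasurable)
  then interpret finite_measure "lebesgue_on \<Omega>" by (rule finite_measure_lebesgue_on)
  have "compact (f ` closure \<Omega>)"
    using assms by (intro compact_continuous_image) (auto simp: compact_closure)
  then have "bounded (f ` closure \<Omega>)" by (rule compact_imp_bounded)
  then obtain B where B: "\<forall>x\<in>closure \<Omega>. norm (f x) \<le> B" unfolding bounded_iff by auto
  have "f \<in> borel_measurable (lebesgue_on \<Omega>)"
    using assms closure_subset
    by (intro continuous_imp_measurable_on_sets_lebesgue) (auto intro: continuous_on_subset)
  then show ?thesis
    using B closure_subset by (intro integrable_const_bound[of _ B] AE_I2) (auto simp: subset_iff)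
qed

lemma L2_continuous:
  assumes "open \<Omega>" "bounded \<Omega>" "continuous_on (closure \<Omega>) f"
  shows "L2 \<Omega> f"
proof -
  have "integrable (lebesgue_on \<Omega>) (\<lambda>x. complex_of_real ((cmod (f x))\<^sup>2))"
    using assms by (intro integrable_on_bounded_open continuous_intros) auto
  then have "integrable (lebesgue_on \<Omega>) (\<lambda>x. (cmod (f x))\<^sup>2)" by (simp only: complex_of_real_integrable_eq)
  then show ?thesis
    using integrable_on_bounded_open[OF assms] by (simp add: L2_def)
qed

text \<open>The measure is finite and \<open>|g| \<le> 1 + |g|^2\<close>.\<close>

lemma L2_imp_integrable:
  assumes "open \<Omega>" "bounded \<Omega>" "L2 \<Omega> g"
  shows "integrable (lebesgue_on \<Omega>) g"
proof -
  have "\<Omega> \<in> lmeasurable" using assms(1,2) by (simp add: bounded_set_imp_lmeasurable)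
  then interpret finite_measure "lebesgue_on \<Omega>" by (rule finite_measure_lebesgue_on)
  have "integrable (lebesgue_on \<Omega>) (\<lambda>x. 1 + (cmod (g x))\<^sup>2)"
    using assms(3) by (auto simp: L2_def)
  moreover have "cmod z \<le> 1 + (cmod z)\<^sup>2" for z
    using sum_squares_bound[of 1 "cmod z"] by (simp add: power2_eq_square) (smt (verit) norm_ge_zero)
  then have "AE x in lebesgue_on \<Omega>. norm (g x) \<le> norm (1 + (cmod (g x))\<^sup>2)"
    by (intro AE_I2) (smt (verit) real_norm_def)
  ultimately show ?thesis
    using assms(3) by (intro Bochner_Integration.integrable_bound[of _ "\<lambda>x. 1 + (cmod (g x))\<^sup>2" g]) (auto simp: L2_def)
qed

text \<open>Integration by parts produces the derivative along the reversed list, which the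
  hypothesis \<open>rev\<close> identifies with the one along \<open>is\<close>. Compact support of
  the test function allows integration over the whole space.\<close>

lemma has_weak_deriv_Dpart:
  fixes u :: "real^'n::finite \<Rightarrow> complex"
  assumes "open \<Omega>" and u: "smooth_on UNIV u" and rev: "Dpart (rev is) u = Dpart is u"
  shows "has_weak_deriv \<Omega> is u (Dpart is u)"
  unfolding has_weak_deriv_def
proof (intro allI impI)
  fix \<phi> assume \<phi>: "test_function \<Omega> \<phi>"
  then have s\<phi>: "smooth_on UNIV \<phi>" and supp: "closure {x. \<phi> x \<noteq> 0} \<subseteq> \<Omega>"
    by (auto simp: test_function_def)
  have restrict: "integral\<^sup>L (lebesgue_on \<Omega>) (\<lambda>x. Dpart js u x * Dpart ks \<phi> x)
      = (\<integral>x. Dpart js u x * Dpart ks \<phi> x \<partial>lborel)" for js ks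
  proof -
    have z: "Dpart ks \<phi> x = 0" if "x \<notin> \<Omega>" for x
      using that supp by (intro Dpart_eq_0_outside_support) auto
    have "integral\<^sup>L (lebesgue_on \<Omega>) (\<lambda>x. Dpart js u x * Dpart ks \<phi> x)
       = (\<integral>x. indicator \<Omega> x *\<^sub>R (Dpart js u x * Dpart ks \<phi> x) \<partial>lebesgue)"
      using assms(1) by (subst integral_restrict_space) auto
    also have "(\<lambda>x. indicator \<Omega> x *\<^sub>R (Dpart js u x * Dpart ks \<phi> x)) = (\<lambda>x. Dpart js u x * Dpart ks \<phi> x)"
      using z by (auto simp: indicator_def fun_eq_iff)
    also have "(\<integral>x. Dpart js u x * Dpart ks \<phi> x \<partial>lebesgue) = (\<integral>x. Dpart js u x * Dpart ks \<phi> x \<partial>lborel)"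
      by (rule integral_completion)
         (simp, intro borel_measurable_continuous_onI continuous_intros smooth_on_UNIV_continuous u s\<phi>)
    finally show ?thesis .
  qed
  show "integral\<^sup>L (lebesgue_on \<Omega>) (\<lambda>x. u x * Dpart is \<phi> x)
       = (-1) ^ length is * integral\<^sup>L (lebesgue_on \<Omega>) (\<lambda>x. Dpart is u x * \<phi> x)"
    using lborel_integration_by_parts[OF u \<phi>, of "[]" "is"] restrict[of "[]" "is"] restrict[of "is" "[]"] rev
    by simp
qed

lemma has_weak_deriv_unique:
  assumes \<Omega>: "open \<Omega>" "bounded \<Omega>" and "L2 \<Omega> g" "L2 \<Omega> g'"
    and "has_weak_deriv \<Omega> is u g" "has_weak_deriv \<Omega> is u g'"
  shows "AE x in lebesgue_on \<Omega>. g x = g' x"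
proof -
  have g: "integrable (lebesgue_on \<Omega>) g" "integrable (lebesgue_on \<Omega>) g'"
    using assms by (auto intro: L2_imp_integrable)
  have "AE x in lebesgue_on \<Omega>. g x - g' x = 0"
  proof (rule fundamental_lemma[OF \<Omega>(1)])
    show "integrable (lebesgue_on \<Omega>) (\<lambda>x. g x - g' x)" using g by simp
    fix \<phi> assume \<phi>: "test_function \<Omega> \<phi>"
    then have "continuous_on UNIV \<phi>"
      using smooth_on_UNIV_continuous[of \<phi> UNIV "[]"] by (simp add: test_function_def)
    then have c: "continuous_on S \<phi>" for S using continuous_on_subset by blast
    have meas: "\<phi> \<in> borel_measurable (lebesgue_on \<Omega>)"
      using \<Omega> c by (intro continuous_imp_measurable_on_sets_lebesgue) auto
    have "compact (\<phi> ` closure \<Omega>)"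
      using \<Omega> c by (intro compact_continuous_image) (auto simp: compact_closure)
    then have "bounded (\<phi> ` closure \<Omega>)" by (rule compact_imp_bounded)
    then obtain B where B: "\<forall>x\<in>closure \<Omega>. norm (\<phi> x) \<le> B" unfolding bounded_iff by auto
    have int: "integrable (lebesgue_on \<Omega>) (\<lambda>x. f x * \<phi> x)" if f: "integrable (lebesgue_on \<Omega>) f" for f
    proof (rule Bochner_Integration.integrable_bound[of _ "\<lambda>x. f x * of_real B"])
      show "AE x in lebesgue_on \<Omega>. norm (f x * \<phi> x) \<le> norm (f x * complex_of_real B)"
      proof (rule AE_I2)
        fix x assume "x \<in> space (lebesgue_on \<Omega>)"
        then have "norm (\<phi> x) \<le> B" using B closure_subset by (auto simp: subset_iff)
        then show "norm (f x * \<phi> x) \<le> norm (f x * complex_of_real B)"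
          by (simp add: norm_mult mult_left_mono)
      qed
    qed (use f meas in auto)
    show "integral\<^sup>L (lebesgue_on \<Omega>) (\<lambda>x. (g x - g' x) * \<phi> x) = 0"
      using assms(5,6) \<phi> int[OF g(1)] int[OF g(2)] by (simp add: has_weak_deriv_def left_diff_distrib)
  qed
  then show ?thesis by eventually_elim simp
qed

text \<open>\<open>weak_deriv\<close> is an arbitrary choice in its almost-everywhere class.
  Agreement with the classical derivative thus holds almost everywhere, and measurability is
  recorded separately for later exchanges under the integral.\<close>

lemma weak_deriv_smooth:
  fixes u :: "real^'n::finite \<Rightarrow> complex"
  assumes \<Omega>: "open \<Omega>" "bounded \<Omega>" and u: "smooth_on UNIV u" and rev: "Dpart (rev is) u = Dpart is u"
  shows weak_deriv_smooth_AE: "AE x in lebesgue_on \<Omega>. weak_deriv \<Omega> is u x = Dpart is u x"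
    and weak_deriv_smooth_measurable: "weak_deriv \<Omega> is u \<in> borel_measurable (lebesgue_on \<Omega>)"
proof -
  have *: "L2 \<Omega> (Dpart is u) \<and> has_weak_deriv \<Omega> is u (Dpart is u)"
    using \<Omega> u rev by (intro conjI L2_continuous has_weak_deriv_Dpart smooth_on_UNIV_continuous)
  then have **: "L2 \<Omega> (weak_deriv \<Omega> is u) \<and> has_weak_deriv \<Omega> is u (weak_deriv \<Omega> is u)"
    using someI[of "\<lambda>g. L2 \<Omega> g \<and> has_weak_deriv \<Omega> is u g"] unfolding weak_deriv_def by blast
  then show "AE x in lebesgue_on \<Omega>. weak_deriv \<Omega> is u x = Dpart is u x"
    using * has_weak_deriv_unique[OF \<Omega>] by blast
  show "weak_deriv \<Omega> is u \<in> borel_measurable (lebesgue_on \<Omega>)"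
    using ** by (simp add: L2_def)
qed

lemma sobolev_H_smooth:
  fixes u :: "real^'n::finite \<Rightarrow> complex"
  assumes \<Omega>: "open \<Omega>" "bounded \<Omega>" and u: "smooth_on UNIV u" and rev: "\<And>is. Dpart (rev is) u = Dpart is u"
  shows "sobolev_H \<Omega> k u"
  unfolding sobolev_H_def
  using L2_continuous[OF \<Omega> smooth_on_UNIV_continuous[OF u]] has_weak_deriv_Dpart[OF \<Omega>(1) u rev]
  by (metis Dpart.simps(1))

text \<open>The generating polynomial is a commutative product over the indices, so their order is
  irrelevant.\<close>

lemma Dpart_rev_bimonomial: "Dpart (rev is) (bimonomial \<theta> \<kappa> p q) = Dpart is (bimonomial \<theta> \<kappa> p q)"
proof -
  have "dpoly \<theta> \<kappa> (rev is) = dpoly \<theta> \<kappa> is"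
    unfolding dpoly_def by (simp add: rev_map[symmetric] prod_list.rev)
  then show ?thesis by (simp add: Dpart_bimonomial bimonomial_deriv_def fun_eq_iff)
qed

lemma polylap_bimonomial:
  fixes \<Omega> :: "(real^'n::finite) set"
  assumes \<Omega>: "open \<Omega>" "bounded \<Omega>"
    and null: "(\<Sum>i\<in>UNIV. \<theta> i * \<theta> i) = 0" "(\<Sum>i\<in>UNIV. \<kappa> i * \<kappa> i) = 0" and pq: "p < m \<or> q < m"
  shows "AE x in lebesgue_on \<Omega>. polylap \<Omega> m (bimonomial \<theta> \<kappa> p q) x = 0"
proof -
  have "AE x in lebesgue_on \<Omega>. \<forall>js\<in>{js::'n list. length js = m}.
      weak_deriv \<Omega> (concat (map (\<lambda>j. [j, j]) js)) (bimonomial \<theta> \<kappa> p q) x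
      = Dpart (concat (map (\<lambda>j. [j, j]) js)) (bimonomial \<theta> \<kappa> p q) x"
    by (intro AE_finite_allI finite_lists_length weak_deriv_smooth_AE \<Omega> smooth_on_bimonomial Dpart_rev_bimonomial)
  then show ?thesis
  proof eventually_elim
    case (elim x)
    then have "polylap \<Omega> m (bimonomial \<theta> \<kappa> p q) x
      = (\<Sum>js\<in>{js::'n list. length js = m}. bimonomial_deriv \<theta> \<kappa> p q (concat (map (\<lambda>j. [j, j]) js)) x)"
      unfolding polylap_def by (intro sum.cong refl) (simp add: Dpart_bimonomial)
    then show ?case using polyharmonic_bimonomial[OF null pq] by simp
  qed
qed

section \<open>Symmetric tensors and moments\<close>

text \<open>The homogeneous polynomial \<open>a(y, ..., y)\<close> of the tensor.\<close>

definition tensor_poly :: "nat \<Rightarrow> ('n::finite list \<Rightarrow> complex) \<Rightarrow> real^'n \<Rightarrow> complex" where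
  "tensor_poly l a y = (\<Sum>is\<in>{is. length is = l}. a is * of_real (prod_list (map (\<lambda>i. y $ i) is)))"

lemma tensor_poly_0: "tensor_poly 0 a y = a []"
  by (simp add: tensor_poly_def)

lemma tensor_poly_Suc: "tensor_poly (Suc l) a y = (\<Sum>j\<in>UNIV. of_real (y $ j) * tensor_poly l (\<lambda>is. a (j # is)) y)"
  by (simp add: tensor_poly_def sum_lists_length_Suc sum_distrib_left algebra_simps)

lemma tensor_poly_scaleR: "tensor_poly l a (c *\<^sub>R y) = of_real c ^ l * tensor_poly l a y"
proof (induction l arbitrary: a)
  case (Suc l)
  then show ?case by (simp add: tensor_poly_Suc sum_distrib_left algebra_simps)
qed (simp add: tensor_poly_0)

text \<open>By symmetry each of the \<open>l\<close> slots contributes the same contraction with the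
  \<open>i\<close>-th basis vector.\<close>

lemma tensor_poly_has_vector_derivative:
  assumes "\<And>is js. length is = l \<Longrightarrow> mset js = mset is \<Longrightarrow> a js = a is"
  shows "((\<lambda>t. tensor_poly l a (y + t *\<^sub>R axis i 1)) has_vector_derivative
     of_nat l * tensor_poly (l - 1) (\<lambda>is. a (i # is)) y) (at 0)"
  using assms
proof (induction l arbitrary: a)
  case 0
  show ?case by (simp add: tensor_poly_0)
next
  case (Suc l)
  have IH: "((\<lambda>t. tensor_poly l (\<lambda>is. a (j # is)) (y + t *\<^sub>R axis i 1)) has_vector_derivative
     of_nat l * tensor_poly (l - 1) (\<lambda>is. a (j # i # is)) y) (at 0)" for j
    by (rule Suc.IH) (auto intro: Suc.prems)
  have coord: "((\<lambda>t. complex_of_real ((y + t *\<^sub>R axis i 1) $ j)) has_vector_derivative (if j = i then 1 else 0)) (at 0)" for j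
  proof -
    have "((\<lambda>t. (y + t *\<^sub>R axis i 1) $ j) has_real_derivative (if j = i then 1 else 0)) (at 0)"
      by (auto intro!: derivative_eq_intros simp: axis_def)
    from has_vector_derivative_of_real[OF this] show ?thesis by (simp split: if_splits)
  qed
  have "((\<lambda>t. tensor_poly (Suc l) a (y + t *\<^sub>R axis i 1)) has_vector_derivative
     (\<Sum>j\<in>UNIV. of_real (y $ j) * (of_nat l * tensor_poly (l - 1) (\<lambda>is. a (j # i # is)) y)
       + (if j = i then 1 else 0) * tensor_poly l (\<lambda>is. a (j # is)) y)) (at 0)"
    unfolding tensor_poly_Suc
    using has_vector_derivative_mult[OF coord IH]
    by (intro has_vector_derivative_sum) simp
  also have "(\<Sum>j\<in>UNIV. of_real (y $ j) * (of_nat l * tensor_poly (l - 1) (\<lambda>is. a (j # i # is)) y)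
       + (if j = i then 1 else 0) * tensor_poly l (\<lambda>is. a (j # is)) y)
     = of_nat l * (\<Sum>j\<in>UNIV. of_real (y $ j) * tensor_poly (l - 1) (\<lambda>is. a (j # i # is)) y)
       + tensor_poly l (\<lambda>is. a (i # is)) y"
    by (simp add: sum.distrib sum_distrib_left mult_ac if_distrib[of "\<lambda>c. c * _"] cong: if_cong)
  also have "of_nat l * (\<Sum>j\<in>UNIV. of_real (y $ j) * tensor_poly (l - 1) (\<lambda>is. a (j # i # is)) y)
     = of_nat l * tensor_poly l (\<lambda>is. a (i # is)) y"
  proof (cases l)
    case (Suc l')
    \<comment> \<open>Symmetry moves \<open>i\<close> to the front, so that the sum over
      \<open>j\<close> becomes the polynomial of the contracted tensor.\<close>
    have "tensor_poly l' (\<lambda>is. a (j # i # is)) y = tensor_poly l' (\<lambda>is. a (i # j # is)) y" for j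
      unfolding tensor_poly_def
      by (intro sum.cong refl arg_cong2[where f = "(*)"] Suc.prems) (auto simp: Suc)
    then show ?thesis using Suc by (simp add: tensor_poly_Suc)
  qed simp
  finally show ?case by (simp add: algebra_simps)
qed

text \<open>Polarization by differentiation: a partial derivative of the zero polynomial is a
  nonzero multiple of the polynomial of a contracted tensor, which is again symmetric and of lower
  order.\<close>

lemma symmetric_tensor_eq_0:
  fixes a :: "'n::finite list \<Rightarrow> complex"
  assumes "\<And>is js. length is = l \<Longrightarrow> mset js = mset is \<Longrightarrow> a js = a is"
    and "\<And>y. tensor_poly l a y = 0" and "length is = l"
  shows "a is = 0"
  using assms
proof (induction l arbitrary: a "is")
  case 0
  show ?case using 0(2)[of 0] 0(3) by (simp add: tensor_poly_0)
next
  case (Suc l)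
  from Suc.prems(3) obtain i js where "is": "is = i # js" "length js = l" by (auto simp: length_Suc_conv)
  have "tensor_poly l (\<lambda>is. a (i # is)) y = 0" for y
  proof -
    have "((\<lambda>t. 0) has_vector_derivative of_nat (Suc l) * tensor_poly l (\<lambda>is. a (i # is)) y) (at 0)"
      using tensor_poly_has_vector_derivative[of "Suc l" a y i] Suc.prems(1) unfolding Suc.prems(2) diff_Suc_1 by blast
    then have "of_nat (Suc l) * tensor_poly l (\<lambda>is. a (i # is)) y = 0"
      using vector_derivative_unique_at has_vector_derivative_const by blast
    then show ?thesis by (simp del: of_nat_Suc)
  qed
  then have "a (i # js) = 0"
    by (intro Suc.IH[of "\<lambda>is. a (i # is)" js] "is"(2)) (auto intro: Suc.prems(1))
  then show ?case by (simp add: "is")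
qed

section \<open>Continuous functions with vanishing moments\<close>

text \<open>The real span of the exponentials \<open>exp (z \<bullet> x)\<close>. It is an algebra,
  and its elements are reached from powers of linear forms through the exponential series.\<close>

inductive exp_sum :: "('a::real_inner \<Rightarrow> real) \<Rightarrow> bool" where
  exp: "exp_sum (\<lambda>x. c * exp (z \<bullet> x))"
| add: "exp_sum f \<Longrightarrow> exp_sum g \<Longrightarrow> exp_sum (\<lambda>x. f x + g x)"

lemma exp_sum_mult_exp: "exp_sum f \<Longrightarrow> exp_sum (\<lambda>x. f x * (c * exp (z \<bullet> x)))"
proof (induction rule: exp_sum.induct)
  case (exp c' z')
  have "exp_sum (\<lambda>x. (c' * c) * exp ((z' + z) \<bullet> x))" by (rule exp_sum.exp)
  then show ?case by (simp add: inner_add_left exp_add mult_ac)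
next
  case (add f g)
  then show ?case using exp_sum.add[OF add.IH] by (simp add: distrib_right)
qed

lemma exp_sum_mult: "exp_sum g \<Longrightarrow> exp_sum f \<Longrightarrow> exp_sum (\<lambda>x. f x * g x)"
proof (induction rule: exp_sum.induct)
  case (exp c z)
  then show ?case by (rule exp_sum_mult_exp)
next
  case (add g h)
  then show ?case using exp_sum.add[OF add.IH(1) add.IH(2)] by (simp add: distrib_left)
qed

lemma exp_sum_continuous: "exp_sum f \<Longrightarrow> continuous_on S f"
  by (induction rule: exp_sum.induct) (auto intro!: continuous_intros)

text \<open>Stone-Weierstrass; distinct \<open>x\<close> and \<open>y\<close> are separated by the
  exponential with frequency \<open>x - y\<close>.\<close>

lemma exp_sum_dense:
  fixes S :: "'a::{real_inner,t2_space} set"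
  assumes "compact S" "continuous_on S \<psi>" "e > 0"
  obtains g where "exp_sum g" "\<And>x. x \<in> S \<Longrightarrow> \<bar>\<psi> x - g x\<bar> < e"
proof -
  interpret function_ring_on "Collect exp_sum" S
  proof
    show "(\<lambda>_. c) \<in> Collect exp_sum" for c using exp_sum.exp[of c 0] by simp
    fix x y :: 'a assume "x \<noteq> y"
    have "exp_sum (\<lambda>w. 1 * exp ((x - y) \<bullet> w))" by (rule exp_sum.exp)
    moreover have "(x - y) \<bullet> x \<noteq> (x - y) \<bullet> y"
      using \<open>x \<noteq> y\<close> by (metis eq_iff_diff_eq_0 inner_diff_right inner_eq_zero_iff)
    ultimately show "\<exists>f\<in>Collect exp_sum. f x \<noteq> f y" by (intro bexI[of _ "\<lambda>w. 1 * exp ((x - y) \<bullet> w)"]) auto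
  qed (auto intro: assms exp_sum.add exp_sum_mult exp_sum_continuous)
  show ?thesis
    using Stone_Weierstrass_basic[OF assms(2,3)] that by blast
qed

text \<open>Termwise integration of the exponential series, with all partial sums dominated by
  \<open>|f| exp |z \<bullet> x|\<close>.\<close>

lemma integral_mult_exp_eq_0:
  fixes f :: "real^'n::finite \<Rightarrow> complex"
  assumes \<Omega>: "open \<Omega>" "bounded \<Omega>" and f: "continuous_on (closure \<Omega>) f"
    and mom: "\<And>N. integral\<^sup>L (lebesgue_on \<Omega>) (\<lambda>x. f x * of_real (z \<bullet> x) ^ N) = 0"
  shows "integral\<^sup>L (lebesgue_on \<Omega>) (\<lambda>x. f x * of_real (exp (z \<bullet> x))) = 0"
proof -
  have int: "integrable (lebesgue_on \<Omega>) (\<lambda>x. f x * of_real (z \<bullet> x) ^ N)" for N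
    using f by (intro integrable_on_bounded_open[OF \<Omega>] continuous_intros)
  define s where "s n x = (\<Sum>N<n. f x * of_real (z \<bullet> x) ^ N / of_real (fact N))" for n x
  have "(\<lambda>n. integral\<^sup>L (lebesgue_on \<Omega>) (s n)) \<longlonglongrightarrow> integral\<^sup>L (lebesgue_on \<Omega>) (\<lambda>x. f x * of_real (exp (z \<bullet> x)))"
  proof (rule integral_dominated_convergence[where w = "\<lambda>x. norm (f x * of_real (exp \<bar>z \<bullet> x\<bar>))"])
    show "integrable (lebesgue_on \<Omega>) (\<lambda>x. norm (f x * of_real (exp \<bar>z \<bullet> x\<bar>)))"
      using f by (intro integrable_norm integrable_on_bounded_open[OF \<Omega>] continuous_intros)
    show "s n \<in> borel_measurable (lebesgue_on \<Omega>)" for n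
      unfolding s_def using int by (intro borel_measurable_sum borel_measurable_divide) auto
    have "integrable (lebesgue_on \<Omega>) (\<lambda>x. f x * of_real (exp (z \<bullet> x)))"
      using f by (intro integrable_on_bounded_open[OF \<Omega>] continuous_intros)
    then show "(\<lambda>x. f x * of_real (exp (z \<bullet> x))) \<in> borel_measurable (lebesgue_on \<Omega>)" by simp
    show "AE x in lebesgue_on \<Omega>. (\<lambda>n. s n x) \<longlonglongrightarrow> f x * of_real (exp (z \<bullet> x))"
    proof (rule AE_I2)
      fix x
      have "(\<lambda>N. f x * of_real ((z \<bullet> x) ^ N /\<^sub>R fact N)) sums (f x * of_real (exp (z \<bullet> x)))"
        by (intro sums_mult sums_of_real exp_converges)
      then show "(\<lambda>n. s n x) \<longlonglongrightarrow> f x * of_real (exp (z \<bullet> x))"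
        unfolding sums_def s_def by (simp add: divide_inverse mult_ac)
    qed
    show "AE x in lebesgue_on \<Omega>. norm (s n x) \<le> norm (f x * of_real (exp \<bar>z \<bullet> x\<bar>))" for n
    proof (rule AE_I2)
      fix x
      have "norm (s n x) \<le> (\<Sum>N<n. norm (f x) * (\<bar>z \<bullet> x\<bar> ^ N /\<^sub>R fact N))"
        unfolding s_def
        by (rule sum_norm_le) (simp add: norm_mult norm_divide norm_power norm_inverse divide_inverse mult_ac)
      also have "\<dots> = norm (f x) * (\<Sum>N<n. \<bar>z \<bullet> x\<bar> ^ N /\<^sub>R fact N)" by (simp add: sum_distrib_left)
      also have "\<dots> \<le> norm (f x) * exp \<bar>z \<bullet> x\<bar>"
        using sum_le_suminf[OF summable_exp_generic[of "\<bar>z \<bullet> x\<bar>"], of "{..<n}"]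
        by (intro mult_left_mono) (auto simp: exp_def)
      finally show "norm (s n x) \<le> norm (f x * of_real (exp \<bar>z \<bullet> x\<bar>))" by (simp add: norm_mult)
    qed
  qed
  moreover have "integral\<^sup>L (lebesgue_on \<Omega>) (s n) = 0" for n
    unfolding s_def using int mom by (subst Bochner_Integration.integral_sum) auto
  ultimately show ?thesis by (simp add: LIMSEQ_const_iff)
qed

text \<open>The vanishing extends from exponentials to all continuous real weights by density.
  Taking the weights \<open>Re f\<close> and \<open>Im f\<close> gives the integral of
  \<open>|f|^2\<close>.\<close>

lemma continuous_moments_eq_0:
  fixes f :: "real^'n::finite \<Rightarrow> complex"
  assumes \<Omega>: "open \<Omega>" "bounded \<Omega>" and f: "continuous_on (closure \<Omega>) f"
    and mom: "\<And>z N. integral\<^sup>L (lebesgue_on \<Omega>) (\<lambda>x. f x * of_real (z \<bullet> x) ^ N) = 0"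
    and x: "x \<in> \<Omega>"
  shows "f x = 0"
proof -
  have cl: "compact (closure \<Omega>)" using \<Omega> by (simp add: compact_closure)
  have int: "integrable (lebesgue_on \<Omega>) (\<lambda>x. f x * of_real (\<psi> x))" if "continuous_on (closure \<Omega>) \<psi>" for \<psi>
    using f that by (intro integrable_on_bounded_open[OF \<Omega>] continuous_intros)
  have expz: "integral\<^sup>L (lebesgue_on \<Omega>) (\<lambda>x. f x * of_real (g x)) = 0" if "exp_sum g" for g
    using that
  proof induction
    case (exp c z)
    have "(\<lambda>x. f x * of_real (c * exp (z \<bullet> x))) = (\<lambda>x. of_real c * (f x * of_real (exp (z \<bullet> x))))"
      by (simp add: mult_ac)
    then show ?case using integral_mult_exp_eq_0[OF \<Omega> f mom] by simp
  next
    case (add g h)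
    then show ?case using int[OF exp_sum_continuous] by (simp add: distrib_left)
  qed
  have contz: "integral\<^sup>L (lebesgue_on \<Omega>) (\<lambda>x. f x * of_real (\<psi> x)) = 0"
    if \<psi>: "continuous_on (closure \<Omega>) \<psi>" for \<psi>
  proof -
    define C where "C = integral\<^sup>L (lebesgue_on \<Omega>) (\<lambda>x. norm (f x))"
    have fint: "integrable (lebesgue_on \<Omega>) f" using integrable_on_bounded_open[OF \<Omega> f] .
    have C: "C \<ge> 0" unfolding C_def by simp
    have "norm (integral\<^sup>L (lebesgue_on \<Omega>) (\<lambda>x. f x * of_real (\<psi> x))) \<le> 0 + e" if e: "e > 0" for e
    proof -
      \<comment> \<open>The summand \<open>1\<close> keeps the quotient meaningful when
        \<open>C = 0\<close>.\<close>
      define \<delta> where "\<delta> = e / (C + 1)"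
      have "\<delta> > 0" using C e by (simp add: \<delta>_def)
      then obtain g where g: "exp_sum g" "\<And>x. x \<in> closure \<Omega> \<Longrightarrow> \<bar>\<psi> x - g x\<bar> < \<delta>"
        using exp_sum_dense[OF cl \<psi>] by blast
      have "integral\<^sup>L (lebesgue_on \<Omega>) (\<lambda>x. f x * of_real (\<psi> x))
          = integral\<^sup>L (lebesgue_on \<Omega>) (\<lambda>x. f x * of_real (\<psi> x) - f x * of_real (g x))"
        using int[OF \<psi>] int[OF exp_sum_continuous[OF g(1)]] expz[OF g(1)] by simp
      also have "norm \<dots> \<le> integral\<^sup>L (lebesgue_on \<Omega>) (\<lambda>x. norm (f x) * \<delta>)"
      proof (rule Bochner_Integration.integral_norm_bound_integral)
        show "integrable (lebesgue_on \<Omega>) (\<lambda>x. f x * of_real (\<psi> x) - f x * of_real (g x))"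
          using int[OF \<psi>] int[OF exp_sum_continuous[OF g(1)]] by simp
        show "integrable (lebesgue_on \<Omega>) (\<lambda>x. norm (f x) * \<delta>)" using fint by simp
        fix x assume "x \<in> space (lebesgue_on \<Omega>)"
        then have "x \<in> closure \<Omega>" using closure_subset by auto
        then have "\<bar>\<psi> x - g x\<bar> \<le> \<delta>" using g(2) by fastforce
        moreover have "norm (f x * of_real (\<psi> x) - f x * of_real (g x)) = norm (f x) * \<bar>\<psi> x - g x\<bar>"
          by (metis norm_mult norm_of_real of_real_diff right_diff_distrib)
        ultimately show "norm (f x * of_real (\<psi> x) - f x * of_real (g x)) \<le> norm (f x) * \<delta>"
          by (simp add: mult_left_mono)
      qed
      also have "\<dots> = C * \<delta>" by (simp add: C_def)
      also have "\<dots> \<le> e" using C e by (simp add: \<delta>_def field_simps)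
      finally show ?thesis by simp
    qed
    then have "norm (integral\<^sup>L (lebesgue_on \<Omega>) (\<lambda>x. f x * of_real (\<psi> x))) \<le> 0" by (rule field_le_epsilon)
    then show ?thesis by simp
  qed
  have re: "continuous_on (closure \<Omega>) (\<lambda>x. Re (f x))" and im: "continuous_on (closure \<Omega>) (\<lambda>x. Im (f x))"
    using f by (auto intro: continuous_intros)
  have sq: "integrable (lebesgue_on \<Omega>) (\<lambda>x. (cmod (f x))\<^sup>2)"
    using L2_continuous[OF \<Omega> f] by (simp add: L2_def)
  \<comment> \<open>This is \<open>f\<close> times its conjugate, written with real weights
    only.\<close>
  have "(\<lambda>x. f x * of_real (Re (f x)) - \<i> * (f x * of_real (Im (f x)))) = (\<lambda>x. of_real ((cmod (f x))\<^sup>2))"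
    by (auto simp: complex_eq_iff fun_eq_iff cmod_power2) (auto simp: power2_eq_square)
  moreover have "integral\<^sup>L (lebesgue_on \<Omega>) (\<lambda>x. f x * of_real (Re (f x)) - \<i> * (f x * of_real (Im (f x)))) = 0"
    using int[OF re] int[OF im] contz[OF re] contz[OF im] by simp
  ultimately have "integral\<^sup>L (lebesgue_on \<Omega>) (\<lambda>x. complex_of_real ((cmod (f x))\<^sup>2)) = 0" by simp
  then have "integral\<^sup>L (lebesgue_on \<Omega>) (\<lambda>x. (cmod (f x))\<^sup>2) = 0"
    by (simp only: integral_complex_of_real of_real_eq_0_iff)
  then have "AE x in lebesgue_on \<Omega>. (cmod (f x))\<^sup>2 = 0"
    using sq by (subst (asm) integral_nonneg_eq_0_iff_AE) auto
  then have ae: "AE x in lebesgue. x \<in> \<Omega> \<longrightarrow> f x = 0"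
    using \<Omega> by (simp add: AE_restrict_space_iff)
  \<comment> \<open>Almost everywhere becomes everywhere: \<open>U\<close> is open by continuity of
    \<open>f\<close>, and an open negligible set is empty.\<close>
  define U where "U = {x\<in>\<Omega>. f x \<noteq> 0}"
  have "open U"
  proof -
    have "continuous_on \<Omega> f" using f closure_subset continuous_on_subset by blast
    then have "open (\<Omega> \<inter> f -` (- {0}))" using \<Omega> continuous_open_preimage by blast
    moreover have "\<Omega> \<inter> f -` (- {0}) = U" by (auto simp: U_def)
    ultimately show ?thesis by simp
  qed
  moreover have "negligible U"
  proof -
    have "{x \<in> space lebesgue. \<not> (x \<in> \<Omega> \<longrightarrow> f x = 0)} = U" by (auto simp: U_def)
    then have "U \<in> null_sets lebesgue"
      using ae \<open>open U\<close> by (subst (asm) AE_iff_null) auto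
    then show ?thesis by (simp add: negligible_iff_null_sets)
  qed
  ultimately have "U = {}" using open_not_negligible by blast
  then show ?thesis using x by (auto simp: U_def)
qed

section \<open>Uniqueness of the coefficients\<close>

text \<open>The coefficient of \<open>X^k\<close> in \<open>(-\<i>)^l a(v, ..., v)\<close> at
  \<open>v = \<kappa> + X \<theta>\<close>, that is, in the symbol of the order \<open>l\<close>
  part along the null plane.\<close>

definition symbol_coeff ::
  "('n::finite \<Rightarrow> complex) \<Rightarrow> ('n \<Rightarrow> complex) \<Rightarrow> nat \<Rightarrow> nat \<Rightarrow> ('n list \<Rightarrow> real^'n \<Rightarrow> complex) \<Rightarrow> real^'n \<Rightarrow> complex" where
  "symbol_coeff \<theta> \<kappa> l k a x = (\<Sum>is\<in>{is. length is = l}. a is x * (- \<i>) ^ l * coeff (dpoly \<theta> \<kappa> is) k)"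

text \<open>Take \<open>u = w^r w'^s\<close> and \<open>v = w^(P-r) w'^(Q-s)\<close>. Once
  \<open>k\<close> derivatives fall on \<open>w\<close> and \<open>l - k\<close> on
  \<open>w'\<close>, the exponents in the product with \<open>v\<close> are \<open>P - k\<close> and
  \<open>Q - (l - k)\<close>. They are independent of \<open>(r, s)\<close>, so the orthogonality
  relation is a falling factorial expansion with the moments as coefficients.\<close>

lemma symbol_coeff_moment_eq_0:
  fixes \<Omega> :: "(real^'n::finite) set" and a :: "nat \<Rightarrow> 'n list \<Rightarrow> real^'n \<Rightarrow> complex"
  assumes \<Omega>: "open \<Omega>" "bounded \<Omega>" and m: "m \<ge> 1"
    and cont: "\<And>l is. l \<le> 2*m - 2 \<Longrightarrow> length is = l \<Longrightarrow> continuous_on (closure \<Omega>) (a l is)"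
    and null: "(\<Sum>i\<in>UNIV. \<theta> i * \<theta> i) = 0" "(\<Sum>i\<in>UNIV. \<kappa> i * \<kappa> i) = 0"
    and orth: "\<And>u v. sobolev_H \<Omega> (2*m) u \<Longrightarrow> sobolev_H \<Omega> (2*m) v \<Longrightarrow>
           (AE x in lebesgue_on \<Omega>. polylap \<Omega> m u x = 0) \<Longrightarrow>
           (AE x in lebesgue_on \<Omega>. polylap \<Omega> m v x = 0) \<Longrightarrow>
           integral\<^sup>L (lebesgue_on \<Omega>)
             (\<lambda>x. \<Sum>l\<le>2*m - 2. \<Sum>is\<in>{is::'n list. length is = l}. a l is x * Dw \<Omega> is u x * v x) = 0"
    and lk: "l \<le> 2*m - 2" "k \<le> l"
  shows "integral\<^sup>L (lebesgue_on \<Omega>) (\<lambda>x. symbol_coeff \<theta> \<kappa> l k (a l) x * bimonomial \<theta> \<kappa> p q x) = 0"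
proof -
  \<comment> \<open>Chosen so that the coefficient with the given indices \<open>l\<close> and
    \<open>k\<close> is the moment against \<open>w^p w'^q\<close>.\<close>
  define P Q where "P = p + k" and "Q = q + (l - k)"
  define d where "d l k = integral\<^sup>L (lebesgue_on \<Omega>)
      (\<lambda>x. symbol_coeff \<theta> \<kappa> l k (a l) x * bimonomial \<theta> \<kappa> (P - k) (Q - (l - k)) x)" for l k
  have int: "integrable (lebesgue_on \<Omega>) (\<lambda>x. symbol_coeff \<theta> \<kappa> l k (a l) x * bimonomial \<theta> \<kappa> p q x)"
    if "l \<le> 2*m - 2" for l k p q
    unfolding symbol_coeff_def using that cont
    by (intro integrable_on_bounded_open[OF \<Omega>] continuous_intros) auto
  have "d l k = 0"
  proof (rule ffact_expansion_zero_on_corners_imp_zero[where P = P and Q = Q and d = d, OF m _ lk])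
    show "k \<le> P" "l - k \<le> Q" by (auto simp: P_def Q_def)
    fix r s assume rs: "r \<le> P" "s \<le> Q" "r < m \<or> s < m" "P - r < m \<or> Q - s < m"
    let ?u = "bimonomial \<theta> \<kappa> r s" and ?v = "bimonomial \<theta> \<kappa> (P - r) (Q - s)"
    \<comment> \<open>The exponents add up only if no subtraction is truncated; in the remaining
      cases a falling factorial makes both sides zero.\<close>
    have prod: "ffact r k * ffact s j * (bimonomial \<theta> \<kappa> (r - k) (s - j) x * ?v x)
       = ffact r k * ffact s j * bimonomial \<theta> \<kappa> (P - k) (Q - j) x" for k j x
    proof (cases "k \<le> r \<and> j \<le> s")
      case True
      then have "(r - k) + (P - r) = P - k" "(s - j) + (Q - s) = Q - j" using rs by auto
      then have "cinner \<theta> x ^ (P - k) = cinner \<theta> x ^ (r - k) * cinner \<theta> x ^ (P - r)"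
        "cinner \<kappa> x ^ (Q - j) = cinner \<kappa> x ^ (s - j) * cinner \<kappa> x ^ (Q - s)"
        by (simp_all only: power_add[symmetric])
      then show ?thesis by (simp add: bimonomial_def)
    qed (auto simp: ffact_eq_0)
    have "0 = integral\<^sup>L (lebesgue_on \<Omega>)
             (\<lambda>x. \<Sum>l\<le>2*m - 2. \<Sum>is\<in>{is::'n list. length is = l}. a l is x * Dw \<Omega> is ?u x * ?v x)"
      using rs by (intro orth[symmetric] sobolev_H_smooth[OF \<Omega>] smooth_on_bimonomial Dpart_rev_bimonomial
          polylap_bimonomial[OF \<Omega> null])
    also have "\<dots> = integral\<^sup>L (lebesgue_on \<Omega>)
             (\<lambda>x. \<Sum>l\<le>2*m - 2. \<Sum>is\<in>{is::'n list. length is = l}. a l is x * ((- \<i>) ^ l * bimonomial_deriv \<theta> \<kappa> r s is x) * ?v x)"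
    \<comment> \<open>The chosen weak derivatives are replaced by the explicit classical ones.
      Finitely many index lists occur, so the exceptional null sets combine.\<close>
    proof (rule integral_cong_AE)
      have am: "a l is \<in> borel_measurable (lebesgue_on \<Omega>)" if "l \<le> 2*m - 2" "length is = l" for l "is"
        using integrable_on_bounded_open[OF \<Omega> cont[OF that]] by simp
      have vm: "bimonomial \<theta> \<kappa> i j \<in> borel_measurable (lebesgue_on \<Omega>)" for i j
        using integrable_on_bounded_open[OF \<Omega> continuous_on_bimonomial] by simp
      have bm: "bimonomial_deriv \<theta> \<kappa> r s is \<in> borel_measurable (lebesgue_on \<Omega>)" for "is"
        unfolding bimonomial_deriv_def using vm by (intro borel_measurable_sum borel_measurable_times) auto
      have wm: "Dw \<Omega> is ?u \<in> borel_measurable (lebesgue_on \<Omega>)" for "is"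
        unfolding Dw_def[abs_def]
        by (intro borel_measurable_times borel_measurable_const
            weak_deriv_smooth_measurable[OF \<Omega> smooth_on_bimonomial Dpart_rev_bimonomial])
      show "(\<lambda>x. \<Sum>l\<le>2*m - 2. \<Sum>is\<in>{is::'n list. length is = l}. a l is x * Dw \<Omega> is ?u x * ?v x)
          \<in> borel_measurable (lebesgue_on \<Omega>)"
        using am vm wm by (intro borel_measurable_sum borel_measurable_times) auto
      show "(\<lambda>x. \<Sum>l\<le>2*m - 2. \<Sum>is\<in>{is::'n list. length is = l}. a l is x * ((- \<i>) ^ l * bimonomial_deriv \<theta> \<kappa> r s is x) * ?v x)
          \<in> borel_measurable (lebesgue_on \<Omega>)"
        using am vm bm by (intro borel_measurable_sum borel_measurable_times) auto
      have "AE x in lebesgue_on \<Omega>. \<forall>l\<in>{..2*m - 2}. \<forall>is\<in>{is::'n list. length is = l}.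
          weak_deriv \<Omega> is ?u x = Dpart is ?u x"
        by (intro AE_finite_allI finite_lists_length finite_atMost
            weak_deriv_smooth_AE[OF \<Omega> smooth_on_bimonomial Dpart_rev_bimonomial])
      then show "AE x in lebesgue_on \<Omega>.
          (\<Sum>l\<le>2*m - 2. \<Sum>is\<in>{is::'n list. length is = l}. a l is x * Dw \<Omega> is ?u x * ?v x)
        = (\<Sum>l\<le>2*m - 2. \<Sum>is\<in>{is::'n list. length is = l}. a l is x * ((- \<i>) ^ l * bimonomial_deriv \<theta> \<kappa> r s is x) * ?v x)"
      proof eventually_elim
        case (elim x)
        show ?case by (intro sum.cong refl) (use elim in \<open>auto simp: Dw_def Dpart_bimonomial\<close>)
      qed
    qed
    also have "\<dots> = integral\<^sup>L (lebesgue_on \<Omega>) (\<lambda>x. \<Sum>l\<le>2*m - 2. \<Sum>k\<le>l. ffact r k * ffact s (l - k) *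
        (symbol_coeff \<theta> \<kappa> l k (a l) x * bimonomial \<theta> \<kappa> (P - k) (Q - (l - k)) x))"
    proof (intro Bochner_Integration.integral_cong refl sum.cong)
      fix x l
      have "(\<Sum>is\<in>{is::'n list. length is = l}. a l is x * ((- \<i>) ^ l * bimonomial_deriv \<theta> \<kappa> r s is x) * ?v x)
        = (\<Sum>is\<in>{is::'n list. length is = l}. \<Sum>k\<le>l. a l is x * (- \<i>) ^ l * coeff (dpoly \<theta> \<kappa> is) k *
            (ffact r k * ffact s (l - k) * (bimonomial \<theta> \<kappa> (r - k) (s - (l - k)) x * ?v x)))"
        unfolding bimonomial_deriv_def
        by (intro sum.cong refl) (auto simp: sum_distrib_left sum_distrib_right mult_ac)
      also have "\<dots> = (\<Sum>is\<in>{is::'n list. length is = l}. \<Sum>k\<le>l. ffact r k * ffact s (l - k) *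
            ((a l is x * (- \<i>) ^ l * coeff (dpoly \<theta> \<kappa> is) k) * bimonomial \<theta> \<kappa> (P - k) (Q - (l - k)) x))"
        unfolding prod by (simp add: mult_ac)
      also have "\<dots> = (\<Sum>k\<le>l. ffact r k * ffact s (l - k) *
          (symbol_coeff \<theta> \<kappa> l k (a l) x * bimonomial \<theta> \<kappa> (P - k) (Q - (l - k)) x))"
        unfolding symbol_coeff_def by (subst sum.swap) (simp add: sum_distrib_left sum_distrib_right)
      finally show "(\<Sum>is\<in>{is::'n list. length is = l}. a l is x * ((- \<i>) ^ l * bimonomial_deriv \<theta> \<kappa> r s is x) * ?v x)
        = (\<Sum>k\<le>l. ffact r k * ffact s (l - k) *
          (symbol_coeff \<theta> \<kappa> l k (a l) x * bimonomial \<theta> \<kappa> (P - k) (Q - (l - k)) x))" .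
    qed
    also have "\<dots> = (\<Sum>l\<le>2*m - 2. \<Sum>k\<le>l. d l k * ffact r k * ffact s (l - k))"
    proof -
      have i1: "integrable (lebesgue_on \<Omega>) (\<lambda>x. ffact r k * ffact s (l - k) *
          (symbol_coeff \<theta> \<kappa> l k (a l) x * bimonomial \<theta> \<kappa> (P - k) (Q - (l - k)) x))" if "l \<in> {..2*m - 2}" for l k
        using int that by (intro integrable_mult_right) auto
      have i2: "integral\<^sup>L (lebesgue_on \<Omega>) (\<lambda>x. ffact r k * ffact s (l - k) *
          (symbol_coeff \<theta> \<kappa> l k (a l) x * bimonomial \<theta> \<kappa> (P - k) (Q - (l - k)) x)) = d l k * ffact r k * ffact s (l - k)" for l k
        unfolding d_def integral_mult_right_zero by (simp only: mult_ac)
      show ?thesis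
        unfolding i2[symmetric] using i1
        by (simp only: Bochner_Integration.integral_sum Bochner_Integration.integrable_sum cong: sum.cong)
    qed
    finally show "(\<Sum>l\<le>2*m - 2. \<Sum>k\<le>l. d l k * ffact r k * ffact s (l - k)) = 0" by simp
  qed
  then show ?thesis by (simp add: d_def P_def Q_def)
qed

section \<open>From null planes to real unit vectors\<close>

text \<open>Gram-Schmidt applied to \<open>z\<close>. If \<open>z\<close> is parallel to
  \<open>e\<close>, any unit vector orthogonal to \<open>e\<close> will do, and dimension at least
  two supplies one.\<close>

lemma unit_orthogonal_decomposition:
  fixes e z :: "'a::euclidean_space"
  assumes "DIM('a) \<ge> 2" "norm e = 1"
  obtains e' \<alpha> \<beta> where "norm e' = 1" "e \<bullet> e' = 0" "z = \<alpha> *\<^sub>R e + \<beta> *\<^sub>R e'"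
proof -
  define r where "r = z - (z \<bullet> e) *\<^sub>R e"
  have ee: "e \<bullet> e = 1" using assms(2) by (simp add: norm_eq_1)
  show ?thesis
  proof (cases "r = 0")
    case True
    obtain y where y: "y \<noteq> 0" "orthogonal e y" using orthogonal_to_vector_exists[OF assms(1)] by blast
    show ?thesis
      by (rule that[of "sgn y" "z \<bullet> e" 0])
         (use y True in \<open>auto simp: r_def norm_sgn orthogonal_def sgn_div_norm\<close>)
  next
    case False
    show ?thesis
      by (rule that[of "sgn r" "z \<bullet> e" "norm r"])
         (use False ee in \<open>auto simp: norm_sgn sgn_div_norm r_def inner_diff_right inner_commute\<close>)
  qed
qed

text \<open>Evaluation of the generating polynomial at \<open>X = 1\<close>.\<close>

lemma sum_coeff_dpoly: "(\<Sum>k\<le>length is. coeff (dpoly \<theta> \<kappa> is) k) = prod_list (map (\<lambda>i. \<kappa> i + \<theta> i) is)"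
proof -
  have "(\<Sum>k\<le>length is. coeff (dpoly \<theta> \<kappa> is) k) = poly (dpoly \<theta> \<kappa> is) 1"
    using degree_dpoly[of \<theta> \<kappa> "is"]
    by (simp add: poly_altdef) (rule sum.mono_neutral_right, auto simp: coeff_eq_0)
  also have "\<dots> = prod_list (map (\<lambda>i. \<kappa> i + \<theta> i) is)"
    by (induction "is") (auto simp: dpoly_def algebra_simps)
  finally show ?thesis .
qed

lemma prod_list_map_of_real:
  "prod_list (map (\<lambda>i. complex_of_real (f i)) is) = of_real (prod_list (map f is))"
  by (induction "is") auto

text \<open>With \<open>e\<close> fixed, \<open>e'\<close> may depend on \<open>z\<close>: it is
  chosen such that \<open>z\<close> lies in the span of \<open>e\<close> and \<open>e'\<close>. Then
  \<open>z \<bullet> x\<close> is a combination of \<open>w\<close> and \<open>w'\<close>, and its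
  powers expand into bimonomials.\<close>

lemma tensor_poly_moment_eq_0:
  fixes \<Omega> :: "(real^'n::finite) set" and a :: "nat \<Rightarrow> 'n list \<Rightarrow> real^'n \<Rightarrow> complex"
  assumes \<Omega>: "open \<Omega>" "bounded \<Omega>" and m: "m \<ge> 1"
    and cont: "\<And>l is. l \<le> 2*m - 2 \<Longrightarrow> length is = l \<Longrightarrow> continuous_on (closure \<Omega>) (a l is)"
    and orth: "\<And>u v. sobolev_H \<Omega> (2*m) u \<Longrightarrow> sobolev_H \<Omega> (2*m) v \<Longrightarrow>
           (AE x in lebesgue_on \<Omega>. polylap \<Omega> m u x = 0) \<Longrightarrow>
           (AE x in lebesgue_on \<Omega>. polylap \<Omega> m v x = 0) \<Longrightarrow>
           integral\<^sup>L (lebesgue_on \<Omega>)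
             (\<lambda>x. \<Sum>l\<le>2*m - 2. \<Sum>is\<in>{is::'n list. length is = l}. a l is x * Dw \<Omega> is u x * v x) = 0"
    and l: "l \<le> 2*m - 2" and card: "CARD('n) \<ge> 2" and e: "norm e = 1"
  shows "integral\<^sup>L (lebesgue_on \<Omega>) (\<lambda>x. tensor_poly l (\<lambda>is. a l is x) e * of_real (z \<bullet> x) ^ N) = 0"
proof -
  obtain e' \<alpha> \<beta> where e': "norm e' = 1" "e \<bullet> e' = 0" "z = \<alpha> *\<^sub>R e + \<beta> *\<^sub>R e'"
    using unit_orthogonal_decomposition[of e z] card e by auto
  define \<theta> \<kappa> :: "'n \<Rightarrow> complex" where "\<theta> i = of_real (e $ i) + \<i> * of_real (e' $ i)"
    and "\<kappa> i = of_real (e $ i) - \<i> * of_real (e' $ i)" for i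
  define f where "f x = tensor_poly l (\<lambda>is. a l is x) e" for x
  have ee: "(\<Sum>i\<in>UNIV. e $ i * e $ i) = 1" "(\<Sum>i\<in>UNIV. e' $ i * e' $ i) = 1" "(\<Sum>i\<in>UNIV. e $ i * e' $ i) = 0"
    using e e' by (auto simp: norm_eq_1 inner_vec_def)
  have "(\<Sum>i\<in>UNIV. \<theta> i * \<theta> i) = of_real ((\<Sum>i\<in>UNIV. e $ i * e $ i) - (\<Sum>i\<in>UNIV. e' $ i * e' $ i))
      + 2 * \<i> * of_real (\<Sum>i\<in>UNIV. e $ i * e' $ i)"
    unfolding \<theta>_def by (simp add: complex_eq_iff sum_subtractf sum.distrib sum_distrib_left)
  then have null1: "(\<Sum>i\<in>UNIV. \<theta> i * \<theta> i) = 0" using ee by simp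
  have "(\<Sum>i\<in>UNIV. \<kappa> i * \<kappa> i) = of_real ((\<Sum>i\<in>UNIV. e $ i * e $ i) - (\<Sum>i\<in>UNIV. e' $ i * e' $ i))
      - 2 * \<i> * of_real (\<Sum>i\<in>UNIV. e $ i * e' $ i)"
    unfolding \<kappa>_def by (simp add: complex_eq_iff sum_subtractf sum.distrib sum_distrib_left sum_negf)
  then have null2: "(\<Sum>i\<in>UNIV. \<kappa> i * \<kappa> i) = 0" using ee by simp
  have coeff0: "integral\<^sup>L (lebesgue_on \<Omega>) (\<lambda>x. symbol_coeff \<theta> \<kappa> l k (a l) x * bimonomial \<theta> \<kappa> p q x) = 0"
    if "k \<le> l" for k p q
    by (rule symbol_coeff_moment_eq_0[OF \<Omega> m _ null1 null2 _ l that]) (rule cont orth; assumption)+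
  \<comment> \<open>Since \<open>\<theta> + \<kappa> = 2 e\<close>, summing over \<open>k\<close>
    removes \<open>e'\<close> and leaves the tensor evaluated at \<open>e\<close> alone.\<close>
  have sum_coeff: "(\<Sum>k\<le>l. symbol_coeff \<theta> \<kappa> l k (a l) x) = (- \<i>) ^ l * 2 ^ l * f x" for x
  proof -
    have "(\<Sum>k\<le>l. symbol_coeff \<theta> \<kappa> l k (a l) x)
        = (\<Sum>is\<in>{is. length is = l}. a l is x * (- \<i>) ^ l * (\<Sum>k\<le>length is. coeff (dpoly \<theta> \<kappa> is) k))"
      unfolding symbol_coeff_def by (subst sum.swap) (auto simp: sum_distrib_left intro!: sum.cong)
    also have "\<dots> = (- \<i>) ^ l * tensor_poly l (\<lambda>is. a l is x) (2 *\<^sub>R e)"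
    proof -
      have "\<kappa> i + \<theta> i = of_real ((2 *\<^sub>R e) $ i)" for i by (simp add: \<theta>_def \<kappa>_def)
      then show ?thesis
        unfolding sum_coeff_dpoly tensor_poly_def
        by (simp only: prod_list_map_of_real sum_distrib_left mult_ac)
    qed
    finally show ?thesis by (simp add: tensor_poly_scaleR f_def)
  qed
  have int: "integrable (lebesgue_on \<Omega>) (\<lambda>x. symbol_coeff \<theta> \<kappa> l k (a l) x * bimonomial \<theta> \<kappa> p q x)" for k p q
    unfolding symbol_coeff_def using l cont
    by (intro integrable_on_bounded_open[OF \<Omega>] continuous_intros) auto
  have bi0: "integral\<^sup>L (lebesgue_on \<Omega>) (\<lambda>x. f x * bimonomial \<theta> \<kappa> p q x) = 0"
    and biint: "integrable (lebesgue_on \<Omega>) (\<lambda>x. f x * bimonomial \<theta> \<kappa> p q x)" for p q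
  proof -
    define c where "c = inverse ((- \<i>) ^ l * 2 ^ l)"
    have c: "c * ((- \<i>) ^ l * 2 ^ l) = 1" unfolding c_def by (rule left_inverse) simp
    have eq: "f x * bimonomial \<theta> \<kappa> p q x = c * (\<Sum>k\<le>l. symbol_coeff \<theta> \<kappa> l k (a l) x * bimonomial \<theta> \<kappa> p q x)" for x
      unfolding sum_distrib_right[symmetric] sum_coeff using c by (metis mult.assoc mult_1)
    show "integrable (lebesgue_on \<Omega>) (\<lambda>x. f x * bimonomial \<theta> \<kappa> p q x)"
      unfolding eq using int by simp
    show "integral\<^sup>L (lebesgue_on \<Omega>) (\<lambda>x. f x * bimonomial \<theta> \<kappa> p q x) = 0"
      unfolding eq using int coeff0 by simp
  qed
  \<comment> \<open>The solution of
    \<open>\<alpha> e + \<beta> e' = A \<theta> + B \<kappa>\<close>.\<close>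
  define A B where "A = (of_real \<alpha> - \<i> * of_real \<beta>) / 2" and "B = (of_real \<alpha> + \<i> * of_real \<beta>) / 2"
  have zx: "of_real (z \<bullet> x) = A * cinner \<theta> x + B * cinner \<kappa> x" for x
  proof -
    have "cinner \<theta> x = of_real (e \<bullet> x) + \<i> * of_real (e' \<bullet> x)" "cinner \<kappa> x = of_real (e \<bullet> x) - \<i> * of_real (e' \<bullet> x)"
      unfolding cinner_def \<theta>_def \<kappa>_def inner_vec_def
      by (simp_all add: complex_eq_iff sum_negf)
    then show ?thesis
      by (simp add: A_def B_def e'(3) inner_add_left complex_eq_iff field_simps)
  qed
  have "of_real (z \<bullet> x) ^ N
      = (\<Sum>k\<le>N. of_nat (N choose k) * A ^ k * B ^ (N - k) * bimonomial \<theta> \<kappa> k (N - k) x)" for x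
    unfolding zx binomial_ring by (simp add: bimonomial_def power_mult_distrib mult_ac)
  then have "f x * of_real (z \<bullet> x) ^ N
      = (\<Sum>k\<le>N. of_nat (N choose k) * A ^ k * B ^ (N - k) * (f x * bimonomial \<theta> \<kappa> k (N - k) x))" for x
    by (simp add: sum_distrib_left mult_ac)
  then have "integral\<^sup>L (lebesgue_on \<Omega>) (\<lambda>x. f x * of_real (z \<bullet> x) ^ N) = 0"
    using bi0 biint by simp
  then show ?thesis by (simp add: f_def)
qed

theorem theorem2p1:
  fixes \<Omega> :: "(real^'n::finite) set"
    and m :: nat
    and a :: "nat \<Rightarrow> 'n list \<Rightarrow> real^'n \<Rightarrow> complex"
  assumes "CARD('n) \<ge> 3"
    and "smooth_bounded_domain \<Omega>"
    and "m \<ge> 2"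
    and "\<And>l. l \<le> 2*m - 2 \<Longrightarrow> smooth_sym_tensor \<Omega> l (a l)"
    and "\<And>u v. sobolev_H \<Omega> (2*m) u \<Longrightarrow> sobolev_H \<Omega> (2*m) v \<Longrightarrow>
           (AE x in lebesgue_on \<Omega>. polylap \<Omega> m u x = 0) \<Longrightarrow>
           (AE x in lebesgue_on \<Omega>. polylap \<Omega> m v x = 0) \<Longrightarrow>
           integral\<^sup>L (lebesgue_on \<Omega>)
             (\<lambda>x. \<Sum>l\<le>2*m - 2. \<Sum>is\<in>{is::'n list. length is = l}. a l is x * Dw \<Omega> is u x * v x) = 0"
  shows "\<forall>l\<le>2*m - 2. \<forall>is::'n list. length is = l \<longrightarrow> (\<forall>x\<in>\<Omega>. a l is x = 0)"
proof (intro allI impI ballI)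
  fix l and "is" :: "'n list" and x assume l: "l \<le> 2*m - 2" and len: "length is = l" and x: "x \<in> \<Omega>"
  have \<Omega>: "open \<Omega>" "bounded \<Omega>" using assms(2) by (auto simp: smooth_bounded_domain_def)
  have cont: "continuous_on (closure \<Omega>) (a l is)" if l: "l \<le> 2*m - 2" "length is = l" for l "is"
  proof -
    obtain g where g: "smooth_on UNIV g" "\<forall>x\<in>closure \<Omega>. g x = a l is x"
      using assms(4)[OF l(1)] l(2) unfolding smooth_sym_tensor_def smooth_on_closure_def by blast
    then show ?thesis
      using smooth_on_UNIV_continuous[OF g(1), of "closure \<Omega>" "[]"] by (simp cong: continuous_on_cong)
  qed
  \<comment> \<open>For fixed \<open>e\<close> this is a continuous scalar function of the base
    point, all of whose moments vanish.\<close>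
  have unit: "tensor_poly l (\<lambda>is. a l is x) e = 0" if e: "norm e = 1" for e
  proof (rule continuous_moments_eq_0[OF \<Omega> _ _ x])
    show "continuous_on (closure \<Omega>) (\<lambda>x. tensor_poly l (\<lambda>is. a l is x) e)"
      unfolding tensor_poly_def using cont l by (intro continuous_intros) auto
    show "integral\<^sup>L (lebesgue_on \<Omega>) (\<lambda>x. tensor_poly l (\<lambda>is. a l is x) e * of_real (z \<bullet> x) ^ N) = 0" for z N
    proof (rule tensor_poly_moment_eq_0[OF \<Omega> _ _ _ l _ e])
      show "1 \<le> m" "2 \<le> CARD('n)" using assms(1,3) by auto
    qed (rule cont assms(5); assumption)+
  qed
  \<comment> \<open>Homogeneity extends the vanishing from the unit sphere to all vectors; for
    \<open>y = 0\<close> any unit vector can serve as \<open>e\<close>.\<close>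
  have "tensor_poly l (\<lambda>is. a l is x) y = 0" for y
  proof -
    obtain e :: "real^'n" where e: "norm e = 1" "y = norm y *\<^sub>R e"
    proof (cases "y = 0")
      case True
      then show ?thesis using that[of "axis undefined 1"] by simp
    next
      case False
      then show ?thesis using that[of "sgn y"] by (simp add: norm_sgn sgn_div_norm)
    qed
    then show ?thesis using unit[OF e(1)] tensor_poly_scaleR[of l _ "norm y" e] by simp
  qed
  moreover have "a l js x = a l is x" if "length is = l" "mset js = mset is" for "is" js
    using assms(4)[OF l] that subsetD[OF closure_subset x] unfolding smooth_sym_tensor_def by blast
  ultimately show "a l is x = 0"
    using symmetric_tensor_eq_0[of l "\<lambda>is. a l is x"] len by blast
qed

end
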